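(* Let $\mathcal{I}$ be a Ramsey finitely homogeneous structure, let $\mathcal{M}$ be a highly saturated model of a theory $T$, and let $m\ge 1$. Then the following are equivalent. (1) There is an $m$-ary trace definition of $\mathcal{I}$ in $\mathcal{M}$. (2) There is a map $I\to M^m$ which is an uncollapsed indiscernible picture of $\mathcal{I}$ in $\mathcal{M}$ over a small set of parameters. Therefore the following are equivalent. (3) $T$ trace defines $\mathcal{I}$. (4) There is an uncollapsed indiscernible picture of $\mathcal{I}$ in $\mathcal{M}$ over a small set of parameters.
   Context: Conventions: structures and theories are first order; theories are complete and consistent; "definable" means definable with parameters. An $m$-ary trace definition of a structure $\mathcal{I}$ in a structure $\mathcal{M}$ is a map $\tau\colon I\to M^m$ such that for every $k\ge 1$ and every $\mathcal{I}$-definable $X\subseteq I^k$ there is an $\mathcal{M}$-definable $Y\subseteq M^{km}$ with $X=\{(a_1,\dots,a_k)\in I^k : (\tau(a_1),\dots,\tau(a_k))\in Y\}$. $T$ trace defines $\mathcal{I}$ if for some $m\ge 1$ there is an $m$-ary trace definition of $\mathcal{I}$ in some model of $T$. "Highly saturated" means $\kappa$-saturated and strongly $\kappa$-homogeneous for a sufficiently large cardinal $\kappa$, and "small" means of cardinality $<\kappa$. A finitely homogeneous structure is a countably infinite structure in a finite relational language such that every isomorphism between finite substructures extends to an automorphism. $\mathrm{Age}(\mathcal{I})$ is the class of finite structures that embed into $\mathcal{I}$. $\mathcal{I}$ is Ramsey if whenever $\mathcal{A},\mathcal{B}\in\mathrm{Age}(\mathcal{I})$ and the embeddings $\mathcal{A}\hookrightarrow\mathcal{I}$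 are colored with finitely many colors, there is an embedding $\iota\colon\mathcal{B}\hookrightarrow\mathcal{I}$ such that all embeddings of $\mathcal{A}$ into the image of $\iota$ have the same color. A picture of $\mathcal{I}$ in $\mathcal{M}$ is a map $\gamma\colon I\to M^m$ for some $m\ge 1$; for $a=(a_1,\dots,a_k)\in I^k$ write $\gamma(a)=(\gamma(a_1),\dots,\gamma(a_k))$. For $A\subseteq M$, $\gamma$ is indiscernible over $A$ if for all $k\ge 1$ and $a,b\in I^k$, $\mathrm{tp}_{\mathcal{I}}(a)=\mathrm{tp}_{\mathcal{I}}(b)$ implies $\mathrm{tp}_{\mathcal{M}}(\gamma(a)|A)=\mathrm{tp}_{\mathcal{M}}(\gamma(b)|A)$; $\gamma$ is uncollapsed over $A$ if for all $k\ge 1$ and $a,b\in I^k$, $\mathrm{tp}_{\mathcal{M}}(\gamma(a)|A)=\mathrm{tp}_{\mathcal{M}}(\gamma(b)|A)$ implies $\mathrm{tp}_{\mathcal{I}}(a)=\mathrm{tp}_{\mathcal{I}}(b)$. *)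

theory Defs
  imports Main "HOL-Library.FuncSet" "HOL-Library.Countable_Set"
begin

unbundle cardinal_syntax

record ('f, 'r) fo_language =
  Funs :: "'f set"
  Rels :: "'r set"
  farity :: "'f \<Rightarrow> nat"
  rarity :: "'r \<Rightarrow> nat"

record ('f, 'r, 'a) fo_structure =
  universe :: "'a set"
  fun_interp :: "'f \<Rightarrow> 'a list \<Rightarrow> 'a"
  rel_interp :: "'r \<Rightarrow> 'a list set"

definition tuples :: "'a set \<Rightarrow> nat \<Rightarrow> 'a list set" where
  "tuples A k = {xs. length xs = k \<and> set xs \<subseteq> A}"

text \<open>The interpretations of symbols outside the language are irrelevant and left unconstrained.\<close>

definition is_structure :: "('f, 'r) fo_language \<Rightarrow> ('f, 'r, 'a) fo_structure \<Rightarrow> bool" where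
  "is_structure L M \<longleftrightarrow>
     universe M \<noteq> {} \<and>
     (\<forall>f\<in>Funs L. \<forall>xs\<in>tuples (universe M) (farity L f). fun_interp M f xs \<in> universe M) \<and>
     (\<forall>R\<in>Rels L. rel_interp M R \<subseteq> tuples (universe M) (rarity L R))"

datatype 'f fo_term = Var nat | App 'f "'f fo_term list"

datatype ('f, 'r) fo_formula =
    Equals "'f fo_term" "'f fo_term"
  | Rel 'r "'f fo_term list"
  | Neg "('f, 'r) fo_formula"
  | Conj "('f, 'r) fo_formula" "('f, 'r) fo_formula"
  | Exists nat "('f, 'r) fo_formula"

fun is_term :: "('f, 'r) fo_language \<Rightarrow> 'f fo_term \<Rightarrow> bool" where
  "is_term L (Var n) = True"
| "is_term L (App f ts) = (f \<in> Funs L \<and> length ts = farity L f \<and> (\<forall>t\<in>set ts. is_term L t))"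

fun is_formula :: "('f, 'r) fo_language \<Rightarrow> ('f, 'r) fo_formula \<Rightarrow> bool" where
  "is_formula L (Equals s t) = (is_term L s \<and> is_term L t)"
| "is_formula L (Rel R ts) = (R \<in> Rels L \<and> length ts = rarity L R \<and> (\<forall>t\<in>set ts. is_term L t))"
| "is_formula L (Neg \<phi>) = is_formula L \<phi>"
| "is_formula L (Conj \<phi> \<psi>) = (is_formula L \<phi> \<and> is_formula L \<psi>)"
| "is_formula L (Exists n \<phi>) = is_formula L \<phi>"

fun term_vars :: "'f fo_term \<Rightarrow> nat set" where
  "term_vars (Var n) = {n}"
| "term_vars (App f ts) = (\<Union>t\<in>set ts. term_vars t)"

fun free_vars :: "('f, 'r) fo_formula \<Rightarrow> nat set" where
  "free_vars (Equals s t) = term_vars s \<union> term_vars t"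
| "free_vars (Rel R ts) = (\<Union>t\<in>set ts. term_vars t)"
| "free_vars (Neg \<phi>) = free_vars \<phi>"
| "free_vars (Conj \<phi> \<psi>) = free_vars \<phi> \<union> free_vars \<psi>"
| "free_vars (Exists n \<phi>) = free_vars \<phi> - {n}"

fun eval_term :: "('f, 'r, 'a) fo_structure \<Rightarrow> (nat \<Rightarrow> 'a) \<Rightarrow> 'f fo_term \<Rightarrow> 'a" where
  "eval_term M e (Var n) = e n"
| "eval_term M e (App f ts) = fun_interp M f (map (eval_term M e) ts)"

fun sat :: "('f, 'r, 'a) fo_structure \<Rightarrow> (nat \<Rightarrow> 'a) \<Rightarrow> ('f, 'r) fo_formula \<Rightarrow> bool" where
  "sat M e (Equals s t) = (eval_term M e s = eval_term M e t)"
| "sat M e (Rel R ts) = (map (eval_term M e) ts \<in> rel_interp M R)"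
| "sat M e (Neg \<phi>) = (\<not> sat M e \<phi>)"
| "sat M e (Conj \<phi> \<psi>) = (sat M e \<phi> \<and> sat M e \<psi>)"
| "sat M e (Exists n \<phi>) = (\<exists>a\<in>universe M. sat M (e(n := a)) \<phi>)"

definition is_sentence :: "('f, 'r) fo_language \<Rightarrow> ('f, 'r) fo_formula \<Rightarrow> bool" where
  "is_sentence L \<phi> \<longleftrightarrow> is_formula L \<phi> \<and> free_vars \<phi> = {}"

text \<open>The choice of assignment is immaterial for sentences.\<close>

definition is_model ::
  "('f, 'r) fo_language \<Rightarrow> ('f, 'r) fo_formula set \<Rightarrow> ('f, 'r, 'a) fo_structure \<Rightarrow> bool" where
  "is_model L T M \<longleftrightarrow> is_structure L M \<and> (\<forall>\<phi>\<in>T. \<forall>e. range e \<subseteq> universe M \<longrightarrow> sat M e \<phi>)"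

text \<open>
  HOL cannot quantify over types inside a formula, so notions that speak of all (or some) models
  of a theory carry a type argument: the models considered are those whose universe is a subset of
  that type, which thus plays the role of the set-theoretic universe. For the type \<open>'a + 'u\<close> with
  \<open>'u\<close> a free type variable, copies of all structures over \<open>'a\<close> and of all structures over \<open>'u\<close>
  occur among these, and there is no bound on their size.
\<close>

definition entails ::
  "'a itself \<Rightarrow> ('f, 'r) fo_language \<Rightarrow> ('f, 'r) fo_formula set \<Rightarrow> ('f, 'r) fo_formula \<Rightarrow> bool" where
  "entails U L T \<phi> \<longleftrightarrow> (\<forall>M :: ('f, 'r, 'a) fo_structure. is_model L T M \<longrightarrow> is_model L {\<phi>} M)"

definition consistent_theory ::
  "'a itself \<Rightarrow> ('f, 'r) fo_language \<Rightarrow> ('f, 'r) fo_formula set \<Rightarrow> bool" where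
  "consistent_theory U L T \<longleftrightarrow> (\<exists>M :: ('f, 'r, 'a) fo_structure. is_model L T M)"

definition complete_theory ::
  "'a itself \<Rightarrow> ('f, 'r) fo_language \<Rightarrow> ('f, 'r) fo_formula set \<Rightarrow> bool" where
  "complete_theory U L T \<longleftrightarrow> (\<forall>\<phi>\<in>T. is_sentence L \<phi>) \<and>
     (\<forall>\<phi>. is_sentence L \<phi> \<longrightarrow> entails U L T \<phi> \<or> entails U L T (Neg \<phi>))"

text \<open>
  A formula with parameters from \<open>A\<close> in the variables \<open>0, \<dots>, n - 1\<close> is a pair \<open>(\<phi>, cs)\<close>, where the
  parameters \<open>cs\<close> are the values of the variables \<open>n, n + 1, \<dots>\<close> of \<open>\<phi>\<close>.
\<close>

definition param_formulas ::
  "('f, 'r) fo_language \<Rightarrow> 'a set \<Rightarrow> nat \<Rightarrow> (('f, 'r) fo_formula \<times> 'a list) set" where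
  "param_formulas L A n =
     {(\<phi>, cs). is_formula L \<phi> \<and> set cs \<subseteq> A \<and> free_vars \<phi> \<subseteq> {..<n + length cs}}"

definition holds ::
  "('f, 'r, 'a) fo_structure \<Rightarrow> 'a list \<Rightarrow> (('f, 'r) fo_formula \<times> 'a list) \<Rightarrow> bool" where
  "holds M xs p = (case p of (\<phi>, cs) \<Rightarrow> sat M (nth (xs @ cs)) \<phi>)"

definition definable ::
  "('f, 'r) fo_language \<Rightarrow> ('f, 'r, 'a) fo_structure \<Rightarrow> nat \<Rightarrow> 'a list set \<Rightarrow> bool" where
  "definable L M k X \<longleftrightarrow>
     (\<exists>p\<in>param_formulas L (universe M) k. X = {xs \<in> tuples (universe M) k. holds M xs p})"

definition tp ::
  "('f, 'r) fo_language \<Rightarrow> ('f, 'r, 'a) fo_structure \<Rightarrow> 'a set \<Rightarrow> 'a list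
    \<Rightarrow> (('f, 'r) fo_formula \<times> 'a list) set" where
  "tp L M A xs = {p \<in> param_formulas L A (length xs). holds M xs p}"

text \<open>
  Embeddings are extensional functions, so that distinct elements of \<open>embeddings L A B\<close> are
  distinct maps on the universe of \<open>A\<close>; colorings of embeddings depend on this.
\<close>

definition embeddings ::
  "('f, 'r) fo_language \<Rightarrow> ('f, 'r, 'a) fo_structure \<Rightarrow> ('f, 'r, 'b) fo_structure \<Rightarrow> ('a \<Rightarrow> 'b) set" where
  "embeddings L A B = {h \<in> universe A \<rightarrow>\<^sub>E universe B. inj_on h (universe A) \<and>
     (\<forall>f\<in>Funs L. \<forall>xs\<in>tuples (universe A) (farity L f).
        h (fun_interp A f xs) = fun_interp B f (map h xs)) \<and>
     (\<forall>R\<in>Rels L. \<forall>xs\<in>tuples (universe A) (rarity L R).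
        xs \<in> rel_interp A R \<longleftrightarrow> map h xs \<in> rel_interp B R)}"

definition isomorphisms ::
  "('f, 'r) fo_language \<Rightarrow> ('f, 'r, 'a) fo_structure \<Rightarrow> ('f, 'r, 'b) fo_structure \<Rightarrow> ('a \<Rightarrow> 'b) set" where
  "isomorphisms L A B = {h \<in> embeddings L A B. h ` universe A = universe B}"

definition automorphisms ::
  "('f, 'r) fo_language \<Rightarrow> ('f, 'r, 'a) fo_structure \<Rightarrow> ('a \<Rightarrow> 'a) set" where
  "automorphisms L M = isomorphisms L M M"

definition substructure ::
  "('f, 'r) fo_language \<Rightarrow> ('f, 'r, 'a) fo_structure \<Rightarrow> ('f, 'r, 'a) fo_structure \<Rightarrow> bool" where
  "substructure L A M \<longleftrightarrow> is_structure L A \<and> universe A \<subseteq> universe M \<and>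
     (\<forall>f\<in>Funs L. \<forall>xs\<in>tuples (universe A) (farity L f). fun_interp A f xs = fun_interp M f xs) \<and>
     (\<forall>R\<in>Rels L. rel_interp A R = rel_interp M R \<inter> tuples (universe A) (rarity L R))"

definition finitely_homogeneous ::
  "('f, 'r) fo_language \<Rightarrow> ('f, 'r, 'a) fo_structure \<Rightarrow> bool" where
  "finitely_homogeneous L I \<longleftrightarrow>
     is_structure L I \<and> Funs L = {} \<and> finite (Rels L) \<and>
     infinite (universe I) \<and> countable (universe I) \<and>
     (\<forall>A B. substructure L A I \<and> finite (universe A) \<and> substructure L B I \<and> finite (universe B) \<longrightarrow>
        (\<forall>h\<in>isomorphisms L A B. \<exists>\<sigma>\<in>automorphisms L I. \<forall>x\<in>universe A. \<sigma> x = h x))"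

text \<open>
  The members of the age are taken with universe in the type of \<open>I\<close>; every finite structure that
  embeds into \<open>I\<close> is isomorphic to one of these.
\<close>

definition Age :: "('f, 'r) fo_language \<Rightarrow> ('f, 'r, 'a) fo_structure \<Rightarrow> ('f, 'r, 'a) fo_structure set" where
  "Age L I = {A. is_structure L A \<and> finite (universe A) \<and> embeddings L A I \<noteq> {}}"

definition ramsey :: "('f, 'r) fo_language \<Rightarrow> ('f, 'r, 'a) fo_structure \<Rightarrow> bool" where
  "ramsey L I \<longleftrightarrow>
     (\<forall>A\<in>Age L I. \<forall>B\<in>Age L I. \<forall>c :: ('a \<Rightarrow> 'a) \<Rightarrow> nat. finite (c ` embeddings L A I) \<longrightarrow>
        (\<exists>\<iota>\<in>embeddings L B I. \<forall>f\<in>embeddings L A I. \<forall>g\<in>embeddings L A I.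
           f ` universe A \<subseteq> \<iota> ` universe B \<and> g ` universe A \<subseteq> \<iota> ` universe B \<longrightarrow> c f = c g))"

text \<open>A cardinal \<open>\<kappa>\<close> is represented by a relation with \<open>Card_order \<kappa>\<close>.\<close>

definition saturated ::
  "'k rel \<Rightarrow> ('f, 'r) fo_language \<Rightarrow> ('f, 'r, 'a) fo_structure \<Rightarrow> bool" where
  "saturated \<kappa> L M \<longleftrightarrow>
     (\<forall>A p. A \<subseteq> universe M \<and> |A| <o \<kappa> \<and> p \<subseteq> param_formulas L A 1 \<and>
        (\<forall>q\<subseteq>p. finite q \<longrightarrow> (\<exists>x\<in>universe M. \<forall>\<psi>\<in>q. holds M [x] \<psi>)) \<longrightarrow>
        (\<exists>x\<in>universe M. \<forall>\<psi>\<in>p. holds M [x] \<psi>))"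

definition elementary_map ::
  "('f, 'r) fo_language \<Rightarrow> ('f, 'r, 'a) fo_structure \<Rightarrow> 'a set \<Rightarrow> ('a \<Rightarrow> 'a) \<Rightarrow> bool" where
  "elementary_map L M A h \<longleftrightarrow> h \<in> A \<rightarrow> universe M \<and>
     (\<forall>xs. set xs \<subseteq> A \<longrightarrow> tp L M {} (map h xs) = tp L M {} xs)"

definition strongly_homogeneous ::
  "'k rel \<Rightarrow> ('f, 'r) fo_language \<Rightarrow> ('f, 'r, 'a) fo_structure \<Rightarrow> bool" where
  "strongly_homogeneous \<kappa> L M \<longleftrightarrow>
     (\<forall>A h. A \<subseteq> universe M \<and> |A| <o \<kappa> \<and> elementary_map L M A h \<longrightarrow>
        (\<exists>\<sigma>\<in>automorphisms L M. \<forall>x\<in>A. \<sigma> x = h x))"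

text \<open>
  ``Sufficiently large'' is read as: larger than \<open>\<aleph>\<^sub>0\<close> and than the number of symbols of the language.
\<close>

definition highly_saturated ::
  "'k rel \<Rightarrow> ('f, 'r) fo_language \<Rightarrow> ('f, 'r, 'a) fo_structure \<Rightarrow> bool" where
  "highly_saturated \<kappa> L M \<longleftrightarrow>
     Card_order \<kappa> \<and> natLeq <o \<kappa> \<and> |Funs L| <o \<kappa> \<and> |Rels L| <o \<kappa> \<and>
     saturated \<kappa> L M \<and> strongly_homogeneous \<kappa> L M"

text \<open>
  Elements of the \<open>m\<close>-th power of the universe of \<open>M\<close> are lists of length \<open>m\<close>; for a tuple \<open>xs\<close> of
  length \<open>k\<close>, the tuple \<open>\<gamma>(xs)\<close> of length \<open>k * m\<close> is \<open>concat (map \<gamma> xs)\<close>.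
\<close>

definition trace_definition ::
  "('g, 's) fo_language \<Rightarrow> ('g, 's, 'i) fo_structure \<Rightarrow> ('f, 'r) fo_language \<Rightarrow> ('f, 'r, 'a) fo_structure
    \<Rightarrow> nat \<Rightarrow> ('i \<Rightarrow> 'a list) \<Rightarrow> bool" where
  "trace_definition LI I LM M m \<tau> \<longleftrightarrow>
     \<tau> \<in> universe I \<rightarrow> tuples (universe M) m \<and>
     (\<forall>k\<ge>1. \<forall>X. definable LI I k X \<longrightarrow>
        (\<exists>Y. definable LM M (k * m) Y \<and>
           X = {xs \<in> tuples (universe I) k. concat (map \<tau> xs) \<in> Y}))"

definition trace_defines ::
  "'a itself \<Rightarrow> ('f, 'r) fo_language \<Rightarrow> ('f, 'r) fo_formula set
    \<Rightarrow> ('g, 's) fo_language \<Rightarrow> ('g, 's, 'i) fo_structure \<Rightarrow> bool" where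
  "trace_defines U LT T LI I \<longleftrightarrow>
     (\<exists>m\<ge>1. \<exists>N :: ('f, 'r, 'a) fo_structure. is_model LT T N \<and> (\<exists>\<tau>. trace_definition LI I LT N m \<tau>))"

definition picture ::
  "('g, 's, 'i) fo_structure \<Rightarrow> ('f, 'r, 'a) fo_structure \<Rightarrow> nat \<Rightarrow> ('i \<Rightarrow> 'a list) \<Rightarrow> bool" where
  "picture I M m \<gamma> \<longleftrightarrow> \<gamma> \<in> universe I \<rightarrow> tuples (universe M) m"

definition indiscernible_picture ::
  "('g, 's) fo_language \<Rightarrow> ('g, 's, 'i) fo_structure \<Rightarrow> ('f, 'r) fo_language \<Rightarrow> ('f, 'r, 'a) fo_structure
    \<Rightarrow> 'a set \<Rightarrow> ('i \<Rightarrow> 'a list) \<Rightarrow> bool" where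
  "indiscernible_picture LI I LM M A \<gamma> \<longleftrightarrow>
     (\<forall>k\<ge>1. \<forall>a\<in>tuples (universe I) k. \<forall>b\<in>tuples (universe I) k.
        tp LI I {} a = tp LI I {} b \<longrightarrow>
        tp LM M A (concat (map \<gamma> a)) = tp LM M A (concat (map \<gamma> b)))"

definition uncollapsed_picture ::
  "('g, 's) fo_language \<Rightarrow> ('g, 's, 'i) fo_structure \<Rightarrow> ('f, 'r) fo_language \<Rightarrow> ('f, 'r, 'a) fo_structure
    \<Rightarrow> 'a set \<Rightarrow> ('i \<Rightarrow> 'a list) \<Rightarrow> bool" where
  "uncollapsed_picture LI I LM M A \<gamma> \<longleftrightarrow>
     (\<forall>k\<ge>1. \<forall>a\<in>tuples (universe I) k. \<forall>b\<in>tuples (universe I) k.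
        tp LM M A (concat (map \<gamma> a)) = tp LM M A (concat (map \<gamma> b)) \<longrightarrow>
        tp LI I {} a = tp LI I {} b)"

definition has_uncollapsed_indiscernible_picture ::
  "'k rel \<Rightarrow> ('g, 's) fo_language \<Rightarrow> ('g, 's, 'i) fo_structure
    \<Rightarrow> ('f, 'r) fo_language \<Rightarrow> ('f, 'r, 'a) fo_structure \<Rightarrow> nat \<Rightarrow> bool" where
  "has_uncollapsed_indiscernible_picture \<kappa> LI I LM M m \<longleftrightarrow>
     (\<exists>\<gamma> A. picture I M m \<gamma> \<and> A \<subseteq> universe M \<and> |A| <o \<kappa> \<and>
        indiscernible_picture LI I LM M A \<gamma> \<and> uncollapsed_picture LI I LM M A \<gamma>)"

end

theory Submission
  imports Defs
begin

text \<open>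
  A \<open>k\<close>-type of \<open>I\<close> is an orbit of the automorphism group and is determined by finitely many atomic
  formulas, so there are only finitely many of them. Hence, for an uncollapsed indiscernible picture,
  a Boolean combination of formulas over \<open>A\<close> separates the types inside a given definable set from
  those outside it, and the picture is itself a trace definition.

  Conversely, let \<open>\<tau>\<close> be a trace definition of \<open>I\<close> in some \<open>N\<close> elementarily equivalent to \<open>M\<close>.
  Finitely many parameters suffice to define the traces of the atomic formulas. Consider the theory,
  in one block of variables for each element of \<open>I\<close> and for these parameters, which says that the
  blocks are an indiscernible picture on which the same formulas trace the atomic formulas of \<open>I\<close>.
  By the Ramsey property each finite part of it is satisfied in \<open>N\<close> by \<open>\<tau> \<circ> \<sigma>\<close> for some
  automorphism \<open>\<sigma>\<close> of \<open>I\<close>. Being a theory in countably many variables without parameters, it is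
  then realized in the saturated structure \<open>M\<close>.
\<close>

section \<open>Assignments, renaming of variables and isomorphisms\<close>

lemma eval_term_cong:
  "(\<And>i. i \<in> term_vars t \<Longrightarrow> e i = e' i) \<Longrightarrow> eval_term M e t = eval_term M e' t"
proof (induction t)
  case (App f ts)
  then have "map (eval_term M e) ts = map (eval_term M e') ts"
    by (intro map_cong refl) auto
  then show ?case
    by (simp del: map_eq_conv)
qed simp

lemma sat_cong:
  "(\<And>i. i \<in> free_vars \<phi> \<Longrightarrow> e i = e' i) \<Longrightarrow> sat M e \<phi> \<longleftrightarrow> sat M e' \<phi>"
proof (induction \<phi> arbitrary: e e')
  case (Equals s t)
  then have "eval_term M e s = eval_term M e' s" "eval_term M e t = eval_term M e' t"
    by (auto intro: eval_term_cong)
  then show ?case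
    by simp
next
  case (Rel R ts)
  then have "map (eval_term M e) ts = map (eval_term M e') ts"
    by (intro map_cong refl eval_term_cong) auto
  then show ?case
    by (simp del: map_eq_conv)
next
  case (Conj \<phi> \<psi>)
  have "sat M e \<phi> \<longleftrightarrow> sat M e' \<phi>" "sat M e \<psi> \<longleftrightarrow> sat M e' \<psi>"
    using Conj.prems by (intro Conj.IH; simp)+
  then show ?case
    by simp
next
  case (Exists n \<phi>)
  have "sat M (e(n := a)) \<phi> \<longleftrightarrow> sat M (e'(n := a)) \<phi>" for a
    using Exists.prems by (intro Exists.IH) auto
  then show ?case
    by simp
next
  case (Neg \<phi>)
  have "sat M e \<phi> \<longleftrightarrow> sat M e' \<phi>"
    using Neg.prems by (intro Neg.IH) auto
  then show ?case
    by simp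
qed

lemma finite_term_vars: "finite (term_vars t)"
  by (induction t) auto

lemma finite_free_vars: "finite (free_vars \<phi>)"
  by (induction \<phi>) (auto simp: finite_term_vars)

section \<open>Capture-avoiding renaming of variables\<close>

fun rename_term :: "(nat \<Rightarrow> nat) \<Rightarrow> 'f fo_term \<Rightarrow> 'f fo_term" where
  "rename_term s (Var n) = Var (s n)"
| "rename_term s (App f ts) = App f (map (rename_term s) ts)"

text \<open>The map \<open>s\<close> may identify variables, as happens when a position is used
  twice in a tuple. Capture is avoided by moving the bound variable outside the finite set of images
  of the free variables.\<close>

fun rename :: "(nat \<Rightarrow> nat) \<Rightarrow> ('f, 'r) fo_formula \<Rightarrow> ('f, 'r) fo_formula" where
  "rename s (Equals t u) = Equals (rename_term s t) (rename_term s u)"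
| "rename s (Rel R ts) = Rel R (map (rename_term s) ts)"
| "rename s (Neg \<phi>) = Neg (rename s \<phi>)"
| "rename s (Conj \<phi> \<psi>) = Conj (rename s \<phi>) (rename s \<psi>)"
| "rename s (Exists n \<phi>) =
     (let n' = (SOME n'. n' \<notin> s ` free_vars \<phi>) in Exists n' (rename (s(n := n')) \<phi>))"

lemma fresh_var: "(SOME n'. n' \<notin> s ` free_vars \<phi>) \<notin> (s ` free_vars \<phi> :: nat set)"
proof -
  have "\<exists>n'. n' \<notin> (s ` free_vars \<phi> :: nat set)"
    by (rule ex_new_if_finite) (auto simp: finite_free_vars)
  then show ?thesis
    by (rule someI_ex)
qed

lemma is_term_rename [simp]: "is_term L (rename_term s t) = is_term L t"
  by (induction t) auto

lemma is_formula_rename [simp]: "is_formula L (rename s \<phi>) = is_formula L \<phi>"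
proof (induction \<phi> arbitrary: s)
  case (Exists n \<phi>)
  show ?case
    unfolding rename.simps Let_def is_formula.simps by (rule Exists.IH)
qed auto

lemma term_vars_rename: "term_vars (rename_term s t) = s ` term_vars t"
  by (induction t) auto

lemma free_vars_rename: "free_vars (rename s \<phi>) \<subseteq> s ` free_vars \<phi>"
proof (induction \<phi> arbitrary: s)
  case (Exists n \<phi>)
  define n' where "n' = (SOME n'. n' \<notin> s ` free_vars \<phi>)"
  have "free_vars (rename (s(n := n')) \<phi>) - {n'} \<subseteq> s ` (free_vars \<phi> - {n})"
  proof -
    have "(s(n := n')) ` free_vars \<phi> - {n'} \<subseteq> s ` (free_vars \<phi> - {n})"
      by auto
    with Exists.IH[of "s(n := n')"] show ?thesis
      by blast
  qed
  then show ?case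
    unfolding rename.simps Let_def free_vars.simps n'_def .
next
  case (Conj \<phi> \<psi>)
  then show ?case
    unfolding rename.simps free_vars.simps image_Un by (intro Un_mono)
qed (auto simp: term_vars_rename)

lemma eval_rename_term: "eval_term M e (rename_term s t) = eval_term M (\<lambda>i. e (s i)) t"
proof (induction t)
  case (App f ts)
  then have "map (eval_term M e) (map (rename_term s) ts) = map (eval_term M (\<lambda>i. e (s i))) ts"
    by simp
  then show ?case
    by (simp only: rename_term.simps eval_term.simps)
qed simp

lemma sat_rename: "sat M e (rename s \<phi>) \<longleftrightarrow> sat M (\<lambda>i. e (s i)) \<phi>"
proof (induction \<phi> arbitrary: s e)
  case (Rel R ts)
  have "map (eval_term M e) (map (rename_term s) ts) = map (eval_term M (\<lambda>i. e (s i))) ts"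
    by (simp add: eval_rename_term)
  then show ?case
    by (simp only: rename.simps sat.simps)
next
  case (Exists n \<phi>)
  define n' where "n' = (SOME n'. n' \<notin> s ` free_vars \<phi>)"
  have n': "n' \<notin> s ` free_vars \<phi>"
    unfolding n'_def by (rule fresh_var)
  \<comment> \<open>Both assignments give \<open>a\<close> to \<open>n\<close>. At any other free
    variable \<open>i\<close> of \<open>\<phi>\<close>, freshness gives
    \<open>s i \<noteq> n'\<close>, so the update at \<open>n'\<close> is not seen.\<close>
  have "sat M (e(n' := a)) (rename (s(n := n')) \<phi>) \<longleftrightarrow> sat M ((\<lambda>i. e (s i))(n := a)) \<phi>" for a
    unfolding Exists.IH using n' by (intro sat_cong) auto
  moreover have "rename s (Exists n \<phi>) = Exists n' (rename (s(n := n')) \<phi>)"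
    unfolding n'_def rename.simps Let_def ..
  ultimately show ?case
    by (simp only: sat.simps)
qed (simp_all only: rename.simps sat.simps eval_rename_term)

text \<open>The form in which renaming is used: a list \<open>js\<close> of indices selects a tuple
  of values, so passing to a subtuple, with repetitions allowed, becomes an operation on
  formulas.\<close>

lemma sat_rename_nth:
  assumes "free_vars \<phi> \<subseteq> {..<length js}"
  shows "sat M e (rename (nth js) \<phi>) \<longleftrightarrow> sat M (nth (map e js)) \<phi>"
  unfolding sat_rename using assms by (intro sat_cong) auto

lemma free_vars_rename_nth:
  "free_vars \<phi> \<subseteq> {..<length js} \<Longrightarrow> free_vars (rename (nth js) \<phi>) \<subseteq> set js"
  using free_vars_rename[of "nth js" \<phi>] by fastforce

section \<open>Invariance of satisfaction under isomorphism, and transport of structures\<close>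

lemma eval_term_embedding:
  assumes "h \<in> embeddings L A B" "is_structure L A"
  shows "is_term L t \<Longrightarrow> (\<And>i. i \<in> term_vars t \<Longrightarrow> e i \<in> universe A) \<Longrightarrow>
    eval_term A e t \<in> universe A \<and> eval_term B (\<lambda>i. h (e i)) t = h (eval_term A e t)"
proof (induction t)
  case (App f ts)
  let ?xs = "map (eval_term A e) ts"
  have "\<forall>t\<in>set ts. eval_term A e t \<in> universe A \<and> eval_term B (\<lambda>i. h (e i)) t = h (eval_term A e t)"
    using App by auto
  then have "?xs \<in> tuples (universe A) (farity L f)" "map (eval_term B (\<lambda>i. h (e i))) ts = map h ?xs"
    using App.prems by (auto simp: tuples_def)
  moreover from this have "h (fun_interp A f ?xs) = fun_interp B f (map (eval_term B (\<lambda>i. h (e i))) ts)"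
    using App.prems assms by (auto simp: embeddings_def simp del: map_map)
  ultimately show ?case
    using App.prems assms by (auto simp: is_structure_def)
qed simp

text \<open>The assignment has to lie in the universe only at the free variables, because it will be
  \<open>nth\<close> of a finite list, whose values past the end are unspecified. Surjectivity of
  \<open>h\<close> handles the quantifier.\<close>

lemma sat_isomorphism:
  assumes "h \<in> isomorphisms L A B" "is_structure L A"
  shows "is_formula L \<phi> \<Longrightarrow> (\<And>i. i \<in> free_vars \<phi> \<Longrightarrow> e i \<in> universe A) \<Longrightarrow>
    sat B (\<lambda>i. h (e i)) \<phi> \<longleftrightarrow> sat A e \<phi>"
proof (induction \<phi> arbitrary: e)
  case (Equals s t)
  have h: "h \<in> embeddings L A B" and inj: "inj_on h (universe A)"
    using assms by (auto simp: isomorphisms_def embeddings_def)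
  show ?case
    using Equals eval_term_embedding[OF h assms(2), of s e] eval_term_embedding[OF h assms(2), of t e]
      inj_on_eq_iff[OF inj, of "eval_term A e s" "eval_term A e t"]
    by (simp del: comp_apply)
next
  case (Rel R ts)
  have h: "h \<in> embeddings L A B"
    using assms by (auto simp: isomorphisms_def)
  have *: "\<forall>t\<in>set ts. eval_term A e t \<in> universe A \<and> eval_term B (\<lambda>i. h (e i)) t = h (eval_term A e t)"
  proof
    fix t assume "t \<in> set ts"
    then show "eval_term A e t \<in> universe A \<and> eval_term B (\<lambda>i. h (e i)) t = h (eval_term A e t)"
      using Rel.prems by (intro eval_term_embedding[OF h assms(2)]) auto
  qed
  then have xs: "map (eval_term A e) ts \<in> tuples (universe A) (rarity L R)"
    and "map (eval_term B (\<lambda>i. h (e i))) ts = map h (map (eval_term A e) ts)"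
    using Rel.prems by (auto simp: tuples_def)
  then show ?case
    using h Rel.prems xs by (auto simp: embeddings_def simp del: map_map)
next
  case (Exists n \<phi>)
  have "sat B ((\<lambda>i. h (e i))(n := h a)) \<phi> \<longleftrightarrow> sat A (e(n := a)) \<phi>" if "a \<in> universe A" for a
  proof -
    have "(\<lambda>i. h (e i))(n := h a) = (\<lambda>i. h ((e(n := a)) i))"
      by auto
    moreover have "sat B (\<lambda>i. h ((e(n := a)) i)) \<phi> \<longleftrightarrow> sat A (e(n := a)) \<phi>"
      using Exists.prems that by (intro Exists.IH) auto
    ultimately show ?thesis
      by (simp only:)
  qed
  moreover have "universe B = h ` universe A"
    using assms by (auto simp: isomorphisms_def)
  ultimately show ?case
    by auto
qed auto

lemma sat_isomorphism_nth:
  assumes "h \<in> isomorphisms L A B" "is_structure L A" "is_formula L \<phi>"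
    "free_vars \<phi> \<subseteq> {..<length xs}" "set xs \<subseteq> universe A"
  shows "sat B (nth (map h xs)) \<phi> \<longleftrightarrow> sat A (nth xs) \<phi>"
proof -
  have "sat B (nth (map h xs)) \<phi> \<longleftrightarrow> sat B (\<lambda>i. h (xs ! i)) \<phi>"
    using assms by (intro sat_cong) auto
  also have "\<dots> \<longleftrightarrow> sat A (nth xs) \<phi>"
    using assms nth_mem[of _ xs] by (intro sat_isomorphism[OF assms(1,2)]) (auto dest!: subsetD)
  finally show ?thesis .
qed

text \<open>The isomorphic copy of \<open>M\<close> along an injective \<open>h\<close>; it serves
  to move a model over \<open>'a\<close> into the type over which \<open>trace_defines\<close>
  ranges.\<close>

definition image_structure ::
  "('a \<Rightarrow> 'b) \<Rightarrow> ('f, 'r, 'a) fo_structure \<Rightarrow> ('f, 'r, 'b) fo_structure" where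
  "image_structure h M =
     \<lparr>universe = h ` universe M,
      fun_interp = \<lambda>f xs. h (fun_interp M f (map (inv_into (universe M) h) xs)),
      rel_interp = \<lambda>R. map h ` rel_interp M R\<rparr>"

lemma image_structure:
  assumes M: "is_structure L M" and inj: "inj_on h (universe M)"
  shows "is_structure L (image_structure h M)"
    and "restrict h (universe M) \<in> isomorphisms L M (image_structure h M)"
proof -
  have inv: "map (inv_into (universe M) h) xs \<in> tuples (universe M) n"
    if "xs \<in> tuples (h ` universe M) n" for xs n
    using that by (auto simp: tuples_def inv_into_into dest!: subsetD)
  show "is_structure L (image_structure h M)"
    unfolding is_structure_def image_structure_def
    using M inv by (fastforce simp: is_structure_def tuples_def)
  have res: "map (restrict h (universe M)) xs = map h xs"
    and "map (inv_into (universe M) h) (map h xs) = xs" if "set xs \<subseteq> universe M" for xs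
    using that inj by (auto simp: map_idI subset_iff)
  moreover have "map h xs \<in> map h ` rel_interp M R \<longleftrightarrow> xs \<in> rel_interp M R"
    if "R \<in> Rels L" "xs \<in> tuples (universe M) (rarity L R)" for R xs
  proof
    assume "map h xs \<in> map h ` rel_interp M R"
    then obtain ys where ys: "ys \<in> rel_interp M R" "map h xs = map h ys"
      by auto
    then have "set xs \<union> set ys \<subseteq> universe M"
      using M that by (fastforce simp: is_structure_def tuples_def)
    then have "xs = ys"
      using ys(2) inj by (meson inj_on_map_eq_map inj_on_subset)
    then show "xs \<in> rel_interp M R"
      using ys by simp
  qed simp
  ultimately show "restrict h (universe M) \<in> isomorphisms L M (image_structure h M)"
    using M inj
    by (auto simp: isomorphisms_def embeddings_def image_structure_def is_structure_def tuples_def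
        simp del: map_map map_eq_conv intro: inj_on_restrict_eq[THEN iffD2])
qed

text \<open>The truth value of a sentence is the same under all assignments, even those leaving the
  universe, and a nonempty universe provides at least one assignment of the kind that
  \<open>is_model\<close> quantifies over.\<close>

lemma is_model_sentence_iff:
  assumes "is_structure L M" "is_sentence L \<phi>"
  shows "is_model L {\<phi>} M \<longleftrightarrow> sat M e \<phi>"
proof -
  have "sat M e' \<phi> \<longleftrightarrow> sat M e \<phi>" for e'
    using assms by (intro sat_cong) (auto simp: is_sentence_def)
  moreover obtain x where "x \<in> universe M"
    using assms by (auto simp: is_structure_def)
  then have "range (\<lambda>n::nat. x) \<subseteq> universe M"
    by auto
  ultimately show ?thesis
    using assms unfolding is_model_def by blast
qed

lemma sat_sentence_isomorphism:
  assumes "h \<in> isomorphisms L A B" "is_structure L A" "is_sentence L \<phi>"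
  shows "sat B e \<phi> \<longleftrightarrow> sat A e' \<phi>"
proof -
  have "sat B e \<phi> \<longleftrightarrow> sat B (\<lambda>i. h (e' i)) \<phi>"
    using assms by (intro sat_cong) (auto simp: is_sentence_def)
  also have "\<dots> \<longleftrightarrow> sat A e' \<phi>"
    using assms by (intro sat_isomorphism) (auto simp: is_sentence_def)
  finally show ?thesis .
qed

lemma is_model_image_structure:
  assumes "is_model L T M" "\<forall>\<phi>\<in>T. is_sentence L \<phi>" "inj_on h (universe M)"
  shows "is_model L T (image_structure h M)"
proof -
  have M: "is_structure L M"
    using assms by (simp add: is_model_def)
  obtain x where "x \<in> universe M"
    using M by (auto simp: is_structure_def)
  then have "sat M (\<lambda>n. x) \<phi>" if "\<phi> \<in> T" for \<phi>
    using assms that by (auto simp: is_model_def)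
  then show ?thesis
    using image_structure[OF M assms(3)] M assms(2)
    by (simp add: is_model_def sat_sentence_isomorphism[where e'="\<lambda>n. x"])
qed

section \<open>Realizing countably many variables in a saturated structure\<close>

text \<open>The empty conjunction is the tautology \<open>Var 0 = Var 0\<close>, so variable 0 is
  always free in the result.\<close>

definition conjs :: "('f, 'r) fo_formula list \<Rightarrow> ('f, 'r) fo_formula" where
  "conjs \<phi>s = foldr Conj \<phi>s (Equals (Var 0) (Var 0))"

lemma sat_conjs [simp]: "sat M e (conjs \<phi>s) \<longleftrightarrow> (\<forall>\<phi>\<in>set \<phi>s. sat M e \<phi>)"
  by (induction \<phi>s) (auto simp: conjs_def)

lemma is_formula_conjs [simp]: "is_formula L (conjs \<phi>s) \<longleftrightarrow> (\<forall>\<phi>\<in>set \<phi>s. is_formula L \<phi>)"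
  by (induction \<phi>s) (auto simp: conjs_def)

definition exs :: "nat list \<Rightarrow> ('f, 'r) fo_formula \<Rightarrow> ('f, 'r) fo_formula" where
  "exs vs \<phi> = foldr Exists vs \<phi>"

lemma is_formula_exs [simp]: "is_formula L (exs vs \<phi>) = is_formula L \<phi>"
  by (induction vs) (auto simp: exs_def)

lemma free_vars_exs [simp]: "free_vars (exs vs \<phi>) = free_vars \<phi> - set vs"
  by (induction vs) (auto simp: exs_def)

lemma sat_exs:
  "sat M e (exs vs \<phi>) \<longleftrightarrow>
     (\<exists>v. (\<forall>i\<in>set vs. v i \<in> universe M) \<and> (\<forall>i. i \<notin> set vs \<longrightarrow> v i = e i) \<and> sat M v \<phi>)"
proof (induction vs arbitrary: e)
  case Nil
  have "v = e" if "\<forall>i. v i = e i" for v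
    using that by auto
  then show ?case
    by (auto simp: exs_def)
next
  case (Cons n vs)
  let ?P = "\<lambda>vs e v. (\<forall>i\<in>set vs. v i \<in> universe M) \<and> (\<forall>i. i \<notin> set vs \<longrightarrow> v i = e i) \<and> sat M v \<phi>"
  have "sat M e (exs (n # vs) \<phi>) \<longleftrightarrow> (\<exists>a\<in>universe M. sat M (e(n := a)) (exs vs \<phi>))"
    by (simp add: exs_def)
  also have "\<dots> \<longleftrightarrow> (\<exists>a\<in>universe M. \<exists>v. ?P vs (e(n := a)) v)"
    by (simp only: Cons.IH)
  also have "\<dots> \<longleftrightarrow> (\<exists>v. ?P (n # vs) e v)"
  proof (intro iffI; elim exE bexE)
    fix a v assume a: "a \<in> universe M" and v: "?P vs (e(n := a)) v"
    \<comment> \<open>If \<open>n\<close> occurs again in \<open>vs\<close>, the inner quantifier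
      overrides \<open>a\<close>; otherwise \<open>v n\<close> is \<open>a\<close>.\<close>
    have "v n \<in> universe M"
      using a v by (cases "n \<in> set vs") auto
    moreover have "v i = e i" if "i \<notin> set (n # vs)" for i
      using v that by simp
    ultimately have "?P (n # vs) e v"
      using v by simp
    then show "\<exists>v. ?P (n # vs) e v"
      by (intro exI[of _ v])
  next
    fix v assume v: "?P (n # vs) e v"
    then have "v i = (e(n := v n)) i" if "i \<notin> set vs" for i
      using that by simp
    then have "?P vs (e(n := v n)) v" "v n \<in> universe M"
      using v by simp_all
    then show "\<exists>a\<in>universe M. \<exists>v. ?P vs (e(n := a)) v"
      by (intro bexI[of _ "v n"] exI[of _ v])
  qed
  finally show ?case .
qed

text \<open>The list \<open>cs\<close> fixes the values of the first variables, while the others may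
  depend on the finite part. Saturation will lengthen \<open>cs\<close> by one value at a
  time.\<close>

definition finitely_satisfiable ::
  "('f, 'r, 'a) fo_structure \<Rightarrow> ('f, 'r) fo_formula set \<Rightarrow> 'a list \<Rightarrow> bool" where
  "finitely_satisfiable M \<Sigma> cs \<longleftrightarrow>
     (\<forall>\<Sigma>0\<subseteq>\<Sigma>. finite \<Sigma>0 \<longrightarrow>
        (\<exists>v. range v \<subseteq> universe M \<and> (\<forall>i<length cs. v i = cs ! i) \<and> (\<forall>\<phi>\<in>\<Sigma>0. sat M v \<phi>)))"

text \<open>A witness for a block of quantifiers is controlled only on the variables
  \<open>V\<close> that matter; this corrects it elsewhere to a total assignment in the
  universe.\<close>

lemma extend_to_universe:
  assumes "x \<in> universe M" "\<And>i. i \<in> V \<Longrightarrow> v i \<in> universe M"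
  obtains v' where "range v' \<subseteq> universe M" "\<And>i. i \<in> V \<Longrightarrow> v' i = v i"
proof (rule that)
  show "range (\<lambda>i. if i \<in> V then v i else x) \<subseteq> universe M"
    using assms by auto
qed simp

text \<open>A finite part of \<open>\<Sigma>\<close>, conjoined and existentially closed, is a
  single sentence, and sentences pass from \<open>N\<close> to \<open>M\<close>.\<close>

lemma finitely_satisfiable_transfer:
  fixes N :: "('f, 'r, 'b) fo_structure" and M :: "('f, 'r, 'a) fo_structure"
  assumes M: "is_structure L M"
    and equiv: "\<And>\<phi> e e'. is_sentence L \<phi> \<Longrightarrow> sat N e \<phi> \<Longrightarrow> sat M e' \<phi>"
    and \<Sigma>: "\<Sigma> \<subseteq> {\<phi>. is_formula L \<phi>}" and fs: "finitely_satisfiable N \<Sigma> []"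
  shows "finitely_satisfiable M \<Sigma> []"
  unfolding finitely_satisfiable_def
proof (intro allI impI)
  fix \<Sigma>0 assume \<Sigma>0: "\<Sigma>0 \<subseteq> \<Sigma>" "finite \<Sigma>0"
  then obtain \<phi>s where \<phi>s: "set \<phi>s = \<Sigma>0"
    using finite_list by blast
  define \<psi> :: "('f, 'r) fo_formula" where "\<psi> = conjs \<phi>s"
  obtain vs where vs: "set vs = free_vars \<psi>"
    using finite_list[OF finite_free_vars[of \<psi>]] by blast
  obtain v where v: "range v \<subseteq> universe N" "\<forall>\<phi>\<in>\<Sigma>0. sat N v \<phi>"
    using fs \<Sigma>0 unfolding finitely_satisfiable_def by blast
  have "sat N v (exs vs \<psi>)"
    unfolding sat_exs by (intro exI[of _ v]) (use v \<phi>s in \<open>simp add: \<psi>_def image_subset_iff\<close>)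
  moreover have "is_sentence L (exs vs \<psi>)"
    using \<Sigma> \<Sigma>0 \<phi>s vs by (auto simp: is_sentence_def \<psi>_def)
  \<comment> \<open>Any assignment will do for a sentence.\<close>
  ultimately have "sat M undefined (exs vs \<psi>)"
    using equiv by simp
  then obtain w where w: "\<forall>i\<in>free_vars \<psi>. w i \<in> universe M" "sat M w \<psi>"
    unfolding sat_exs vs by blast
  obtain x where "x \<in> universe M"
    using M by (auto simp: is_structure_def)
  then obtain w' where w': "range w' \<subseteq> universe M" "\<And>i. i \<in> free_vars \<psi> \<Longrightarrow> w' i = w i"
    by (rule extend_to_universe[of x M "free_vars \<psi>" w]) (use w(1) in auto)
  then have "sat M w' \<psi>"
    using w(2) by (subst sat_cong[of _ _ w]) auto
  then show "\<exists>v. range v \<subseteq> universe M \<and> (\<forall>i<length []. v i = [] ! i) \<and> (\<forall>\<phi>\<in>\<Sigma>0. sat M v \<phi>)"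
    using w'(1) \<phi>s by (intro exI[of _ w']) (simp add: \<psi>_def)
qed

lemma finite_ordLess_natLeq: "finite A \<Longrightarrow> natLeq <o \<kappa> \<Longrightarrow> |A| <o \<kappa>"
  using ordLess_transitive[of "|A|" natLeq \<kappa>] by (simp add: finite_iff_ordLess_natLeq)

text \<open>Consider the type over \<open>cs\<close> which says of \<open>x\<close>, for each finite
  part of \<open>\<Sigma>\<close>, that the part can be satisfied by a choice of the later variables
  when \<open>x\<close> is the value of variable \<open>length cs\<close>. It is finitely
  satisfiable because \<open>\<Sigma>\<close> is so with \<open>cs\<close>, and a realization is the
  next value.\<close>

lemma finitely_satisfiable_extend:
  fixes M :: "('f, 'r, 'a) fo_structure"
  assumes M: "is_structure L M" and sat: "saturated \<kappa> L M" "natLeq <o \<kappa>"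
    and \<Sigma>: "\<Sigma> \<subseteq> {\<phi>. is_formula L \<phi>}"
    and cs: "set cs \<subseteq> universe M" and fs: "finitely_satisfiable M \<Sigma> cs"
  shows "\<exists>x\<in>universe M. finitely_satisfiable M \<Sigma> (cs @ [x])"
proof -
  define n where "n = length cs"
  \<comment> \<open>In \<open>\<Sigma>\<close> the values \<open>cs\<close> belong to the variables
    below \<open>n\<close> and the new element to \<open>n\<close>. In a formula with parameters the
    new element is variable 0 and the parameters follow, hence this cyclic shift. All variables
    beyond \<open>n\<close> get quantified.\<close>
  define s where "s i = (if i < n then Suc i else if i = n then 0 else i)" for i
  define vs where "vs \<phi>s = (SOME vs. set vs = free_vars (conjs \<phi>s) - {..n})"
    for \<phi>s :: "('f, 'r) fo_formula list"
  have vs: "set (vs \<phi>s) = free_vars (conjs \<phi>s) - {..n}" for \<phi>s :: "('f, 'r) fo_formula list"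
    unfolding vs_def by (rule someI_ex, rule finite_list) (simp add: finite_free_vars)
  define \<psi> where "\<psi> \<phi>s = (rename s (exs (vs \<phi>s) (conjs \<phi>s)), cs)"
    for \<phi>s :: "('f, 'r) fo_formula list"
  have fv: "free_vars (exs (vs \<phi>s) (conjs \<phi>s)) \<subseteq> {..n}" for \<phi>s :: "('f, 'r) fo_formula list"
    by (auto simp: vs)
  have \<psi>_iff: "holds M [x] (\<psi> \<phi>s) \<longleftrightarrow>
      (\<exists>v. range v \<subseteq> universe M \<and> (\<forall>i\<le>n. v i = (cs @ [x]) ! i) \<and> (\<forall>\<phi>\<in>set \<phi>s. sat M v \<phi>))"
    if x: "x \<in> universe M" for x \<phi>s
  proof -
    have "holds M [x] (\<psi> \<phi>s) \<longleftrightarrow> sat M (\<lambda>i. (x # cs) ! s i) (exs (vs \<phi>s) (conjs \<phi>s))"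
      by (simp add: holds_def \<psi>_def sat_rename)
    also have "\<dots> \<longleftrightarrow> sat M (nth (cs @ [x])) (exs (vs \<phi>s) (conjs \<phi>s))"
      using fv[of \<phi>s] by (intro sat_cong) (auto simp: s_def n_def nth_append)
    also have "\<dots> \<longleftrightarrow>
      (\<exists>v. range v \<subseteq> universe M \<and> (\<forall>i\<le>n. v i = (cs @ [x]) ! i) \<and> (\<forall>\<phi>\<in>set \<phi>s. sat M v \<phi>))"
      (is "_ \<longleftrightarrow> ?R")
    proof
      assume "sat M (nth (cs @ [x])) (exs (vs \<phi>s) (conjs \<phi>s))"
      then obtain v where v: "\<forall>i\<in>set (vs \<phi>s). v i \<in> universe M"
        "\<forall>i. i \<notin> set (vs \<phi>s) \<longrightarrow> v i = (cs @ [x]) ! i" "sat M v (conjs \<phi>s)"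
        unfolding sat_exs by blast
      have in_n: "v i = (cs @ [x]) ! i" if "i \<le> n" for i
        using v(2) that by (auto simp: vs)
      have "(cs @ [x]) ! i \<in> universe M" if "i \<le> n" for i
        using that cs x nth_mem[of i "cs @ [x]"] by (auto simp: n_def)
      with in_n v(1) have "v i \<in> universe M" if "i \<in> {..n} \<union> set (vs \<phi>s)" for i
        using that by auto
      \<comment> \<open>Outside \<open>{..n}\<close> and the quantified variables, \<open>v\<close>
        is \<open>nth\<close> past the end of the list and may leave the universe.\<close>
      then obtain v' where v': "range v' \<subseteq> universe M" "\<And>i. i \<in> {..n} \<union> set (vs \<phi>s) \<Longrightarrow> v' i = v i"
        using extend_to_universe[OF x, of "{..n} \<union> set (vs \<phi>s)" v] by metis
      have "sat M v' (conjs \<phi>s)"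
        using v(3) v'(2) vs[of \<phi>s] by (subst sat_cong[of _ _ v]) auto
      with v'(1) v'(2) in_n show ?R
        by (intro exI[of _ v']) simp
    next
      assume ?R
      then obtain v where v: "range v \<subseteq> universe M" "\<forall>i\<le>n. v i = (cs @ [x]) ! i" "\<forall>\<phi>\<in>set \<phi>s. sat M v \<phi>"
        by blast
      then have "sat M v (exs (vs \<phi>s) (conjs \<phi>s))"
        unfolding sat_exs by (intro exI[of _ v]) auto
      then show "sat M (nth (cs @ [x])) (exs (vs \<phi>s) (conjs \<phi>s))"
        using fv[of \<phi>s] v(2) by (subst sat_cong[of _ _ v]) auto
    qed
    finally show ?thesis .
  qed
  let ?p = "\<psi> ` {\<phi>s. set \<phi>s \<subseteq> \<Sigma>}"
  have "?p \<subseteq> param_formulas L (set cs) 1"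
  proof (rule image_subsetI)
    fix \<phi>s assume "\<phi>s \<in> {\<phi>s. set \<phi>s \<subseteq> \<Sigma>}"
    moreover have "s ` {..n} \<subseteq> {..<1 + length cs}"
      by (auto simp: s_def n_def)
    then have "free_vars (rename s (exs (vs \<phi>s) (conjs \<phi>s))) \<subseteq> {..<1 + length cs}"
      using free_vars_rename[of s "exs (vs \<phi>s) (conjs \<phi>s)"] fv[of \<phi>s] by (meson image_mono order_trans)
    ultimately show "\<psi> \<phi>s \<in> param_formulas L (set cs) 1"
      using \<Sigma> by (auto simp: \<psi>_def param_formulas_def simp del: free_vars_exs)
  qed
  moreover have "\<exists>x\<in>universe M. \<forall>\<psi>\<in>q. holds M [x] \<psi>" if q: "q \<subseteq> ?p" "finite q" for q
  proof -
    obtain F where F: "F \<subseteq> {\<phi>s. set \<phi>s \<subseteq> \<Sigma>}" "finite F" "q = \<psi> ` F"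
      using finite_subset_image[OF q(2,1)] by auto
    \<comment> \<open>The finitely many lists behind \<open>q\<close> are merged into one finite
      part of \<open>\<Sigma>\<close>; an assignment \<open>v\<close> for it gives the common
      witness \<open>v n\<close>.\<close>
    define \<Sigma>0 where "\<Sigma>0 = (\<Union>\<phi>s\<in>F. set \<phi>s)"
    have "\<Sigma>0 \<subseteq> \<Sigma>" "finite \<Sigma>0"
      using F by (auto simp: \<Sigma>0_def)
    then obtain v where v: "range v \<subseteq> universe M" "\<forall>i<n. v i = cs ! i" "\<forall>\<phi>\<in>\<Sigma>0. sat M v \<phi>"
      using fs unfolding finitely_satisfiable_def n_def by metis
    have "holds M [v n] (\<psi> \<phi>s)" if "\<phi>s \<in> F" for \<phi>s
    proof (subst \<psi>_iff)
      show "v n \<in> universe M"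
        using v(1) by auto
      have "\<forall>i\<le>n. v i = (cs @ [v n]) ! i"
        using v(2) by (auto simp: nth_append n_def)
      moreover have "\<forall>\<phi>\<in>set \<phi>s. sat M v \<phi>"
        using v(3) that by (auto simp: \<Sigma>0_def)
      ultimately show "\<exists>w. range w \<subseteq> universe M \<and> (\<forall>i\<le>n. w i = (cs @ [v n]) ! i) \<and>
          (\<forall>\<phi>\<in>set \<phi>s. sat M w \<phi>)"
        using v(1) by (intro exI[of _ v] conjI)
    qed
    then show ?thesis
      using v(1) F(3) by (intro bexI[of _ "v n"]) auto
  qed
  moreover have "|set cs| <o \<kappa>"
    using sat(2) by (rule finite_ordLess_natLeq[OF finite_set])
  ultimately obtain x where x: "x \<in> universe M" "\<forall>\<phi>\<in>?p. holds M [x] \<phi>"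
    using sat(1)[unfolded saturated_def, THEN spec[of _ "set cs"], THEN spec[of _ ?p]] cs by auto
  have "finitely_satisfiable M \<Sigma> (cs @ [x])"
    unfolding finitely_satisfiable_def
  proof (intro allI impI)
    fix \<Sigma>0 assume \<Sigma>0: "\<Sigma>0 \<subseteq> \<Sigma>" "finite \<Sigma>0"
    then obtain \<phi>s where \<phi>s: "set \<phi>s = \<Sigma>0"
      using finite_list by blast
    then have "holds M [x] (\<psi> \<phi>s)"
      using x(2) \<Sigma>0 by auto
    then show "\<exists>v. range v \<subseteq> universe M \<and> (\<forall>i<length (cs @ [x]). v i = (cs @ [x]) ! i) \<and>
        (\<forall>\<phi>\<in>\<Sigma>0. sat M v \<phi>)"
      unfolding \<psi>_iff[OF x(1)] \<phi>s by (simp add: n_def less_Suc_eq_le)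
  qed
  then show ?thesis
    using x(1) by blast
qed

text \<open>Values are chosen one after another, keeping \<open>\<Sigma>\<close> finitely
  satisfiable; each stage has only finitely many parameters. A formula has finitely many free
  variables, so its truth under the limit assignment is settled at a finite stage.\<close>

lemma saturated_realizes:
  fixes M :: "('f, 'r, 'a) fo_structure"
  assumes M: "is_structure L M" and sat: "saturated \<kappa> L M" "natLeq <o \<kappa>"
    and \<Sigma>: "\<Sigma> \<subseteq> {\<phi>. is_formula L \<phi>}" and fs: "finitely_satisfiable M \<Sigma> []"
  obtains v where "range v \<subseteq> universe M" "\<And>\<phi>. \<phi> \<in> \<Sigma> \<Longrightarrow> sat M v \<phi>"
proof -
  define P where "P n cs \<longleftrightarrow> length cs = n \<and> set cs \<subseteq> universe M \<and> finitely_satisfiable M \<Sigma> cs"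
    for n and cs :: "'a list"
  have "\<exists>f. \<forall>n. P n (f n) \<and> (\<exists>x. f (Suc n) = f n @ [x])"
  proof (rule dependent_nat_choice)
    show "\<exists>cs. P 0 cs"
      using fs by (auto simp: P_def)
  next
    fix cs n assume "P n cs"
    then obtain x where "x \<in> universe M" "finitely_satisfiable M \<Sigma> (cs @ [x])"
      using finitely_satisfiable_extend[OF M sat \<Sigma>, of cs] by (auto simp: P_def)
    with \<open>P n cs\<close> show "\<exists>ds. P (Suc n) ds \<and> (\<exists>x. ds = cs @ [x])"
      by (intro exI[of _ "cs @ [x]"]) (simp add: P_def)
  qed
  then obtain f where f: "\<And>n. P n (f n)" "\<And>n. \<exists>x. f (Suc n) = f n @ [x]"
    by blast
  define v where "v i = f (Suc i) ! i" for i
  have len: "length (f n) = n" for n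
    using f(1) by (simp add: P_def)
  have f_nth: "f n ! i = v i" if "i < n" for n i
    using that
  proof (induction n)
    case (Suc n)
    then show ?case
      using f(2)[of n] len[of n] by (cases "i = n") (auto simp: v_def nth_append)
  qed simp
  have "v i \<in> universe M" for i
    using f(1)[of "Suc i"] nth_mem[of i "f (Suc i)"] by (auto simp: P_def v_def)
  moreover have "sat M v \<phi>" if "\<phi> \<in> \<Sigma>" for \<phi>
  proof -
    obtain n where n: "free_vars \<phi> \<subseteq> {..<n}"
      using finite_free_vars[of \<phi>] by (auto simp: finite_nat_iff_bounded)
    have "\<exists>w. range w \<subseteq> universe M \<and> (\<forall>i<n. w i = f n ! i) \<and> (\<forall>\<phi>\<in>{\<phi>}. sat M w \<phi>)"
      using f(1)[of n] that unfolding P_def finitely_satisfiable_def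
      by (metis (no_types, lifting) empty_subsetI finite.emptyI finite.insertI insert_subset)
    then obtain w where "\<forall>i<n. w i = f n ! i" "sat M w \<phi>"
      by auto
    then show ?thesis
      using n f_nth by (subst sat_cong[of _ _ w]) auto
  qed
  ultimately show ?thesis
    by (intro that[of v]) auto
qed

section \<open>Types in a Ramsey finitely homogeneous structure\<close>

definition induced :: "('g, 's) fo_language \<Rightarrow> ('g, 's, 'i) fo_structure \<Rightarrow> 'i set \<Rightarrow> ('g, 's, 'i) fo_structure" where
  "induced LI I B = I\<lparr>universe := B, rel_interp := \<lambda>R. rel_interp I R \<inter> tuples B (rarity LI R)\<rparr>"

lemma universe_induced [simp]: "universe (induced LI I B) = B"
  by (simp add: induced_def)

lemma rel_interp_induced [simp]:
  "rel_interp (induced LI I B) R = rel_interp I R \<inter> tuples B (rarity LI R)"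
  by (simp add: induced_def)

lemma map_in_tuples: "xs \<in> tuples A n \<Longrightarrow> h ` A \<subseteq> B \<Longrightarrow> map h xs \<in> tuples B n"
  by (auto simp: tuples_def)

lemma substructure_induced:
  assumes "Funs LI = {}" "B \<subseteq> universe I" "B \<noteq> {}"
  shows "substructure LI (induced LI I B) I"
  using assms by (auto simp: substructure_def is_structure_def)

text \<open>A partial isomorphism of \<open>I\<close> with domain \<open>B\<close>, stated for total
  functions so that the extensionality of \<open>embeddings\<close> enters only through
  \<open>restrict\<close>.\<close>

definition preserves_rels :: "('g, 's) fo_language \<Rightarrow> ('g, 's, 'i) fo_structure \<Rightarrow> 'i set \<Rightarrow> ('i \<Rightarrow> 'i) \<Rightarrow> bool" where
  "preserves_rels LI I B h \<longleftrightarrow> inj_on h B \<and> h ` B \<subseteq> universe I \<and>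
     (\<forall>R\<in>Rels LI. \<forall>xs\<in>tuples B (rarity LI R). xs \<in> rel_interp I R \<longleftrightarrow> map h xs \<in> rel_interp I R)"

lemma map_restrict: "xs \<in> tuples B n \<Longrightarrow> map (restrict h B) xs = map h xs"
  by (auto simp: tuples_def)

lemma restrict_in_embeddings:
  assumes "Funs LI = {}" "preserves_rels LI I B h"
  shows "restrict h B \<in> embeddings LI (induced LI I B) I"
  using assms unfolding embeddings_def preserves_rels_def
  by (auto simp: map_restrict inj_on_restrict_eq simp del: map_eq_conv)

text \<open>This is homogeneity applied to the substructures on \<open>B\<close> and on its image,
  which the restriction of \<open>h\<close> makes isomorphic.\<close>

lemma preserves_rels_extends:
  assumes fh: "finitely_homogeneous LI I" and B: "finite B" "B \<subseteq> universe I" "B \<noteq> {}"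
    and h: "preserves_rels LI I B h"
  obtains \<sigma> where "\<sigma> \<in> automorphisms LI I" "\<And>x. x \<in> B \<Longrightarrow> \<sigma> x = h x"
proof -
  have Funs: "Funs LI = {}"
    using fh by (simp add: finitely_homogeneous_def)
  have "h ` B \<subseteq> universe I"
    using h by (simp add: preserves_rels_def)
  then have sub: "substructure LI (induced LI I B) I" "substructure LI (induced LI I (h ` B)) I"
    using Funs B by (auto intro: substructure_induced)
  have "restrict h B \<in> isomorphisms LI (induced LI I B) (induced LI I (h ` B))"
    using Funs h map_in_tuples[of _ B _ h "h ` B"] unfolding isomorphisms_def embeddings_def preserves_rels_def
    by (auto simp: map_restrict inj_on_restrict_eq simp del: map_eq_conv)
  then obtain \<sigma> where "\<sigma> \<in> automorphisms LI I" "\<forall>x\<in>B. \<sigma> x = restrict h B x"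
    using fh sub B(1) unfolding finitely_homogeneous_def
    by (metis finite_imageI universe_induced)
  then show ?thesis
    using that by auto
qed

lemma automorphism_preserves_rels:
  assumes "\<sigma> \<in> automorphisms LI I" "B \<subseteq> universe I"
  shows "preserves_rels LI I B \<sigma>"
proof -
  have "xs \<in> tuples (universe I) n" if "xs \<in> tuples B n" for xs n
    using that assms by (auto simp: tuples_def)
  then show ?thesis
    using assms unfolding preserves_rels_def automorphisms_def isomorphisms_def embeddings_def
    by (auto intro: inj_on_subset)
qed

text \<open>
  One application of the Ramsey property suffices even though the tuples \<open>a j\<close> have different
  types: an embedding of the finite set \<open>B\<close> spanned by all the tuples is colored by the set of
  those \<open>j\<close> for which it maps \<open>a j\<close> into \<open>P j\<close>, and the identity is compared with the embeddings
  \<open>\<rho> j\<close>.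
\<close>

lemma ramsey_automorphism:
  assumes fh: "finitely_homogeneous LI I" and ramsey: "ramsey LI I"
    and J: "finite J" and a: "\<And>j. j \<in> J \<Longrightarrow> set (a j) \<subseteq> universe I"
    and \<rho>: "\<And>j. j \<in> J \<Longrightarrow> \<rho> j \<in> automorphisms LI I"
  obtains \<sigma> where "\<sigma> \<in> automorphisms LI I"
    and "\<And>j. j \<in> J \<Longrightarrow> P j (map \<sigma> (a j)) \<longleftrightarrow> P j (map \<sigma> (map (\<rho> j) (a j)))"
proof -
  have Funs: "Funs LI = {}"
    using fh by (simp add: finitely_homogeneous_def)
  obtain x0 where x0: "x0 \<in> universe I"
    using fh by (auto simp: finitely_homogeneous_def is_structure_def)
  \<comment> \<open>The point \<open>x0\<close> keeps \<open>B\<close> nonempty when there are no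
    tuples or only empty ones. The set \<open>C\<close> has room for \<open>B\<close> and all its
    images under the \<open>\<rho> j\<close>.\<close>
  define B where "B = insert x0 (\<Union>j\<in>J. set (a j))"
  define C where "C = B \<union> (\<Union>j\<in>J. \<rho> j ` B)"
  have B: "finite B" "B \<subseteq> universe I" "B \<noteq> {}"
    using J a x0 by (auto simp: B_def)
  have \<rho>_univ: "\<rho> j ` B \<subseteq> universe I" if "j \<in> J" for j
    using automorphism_preserves_rels[OF \<rho>[OF that] B(2)] by (simp add: preserves_rels_def)
  then have C: "finite C" "C \<subseteq> universe I" "C \<noteq> {}"
    using J B by (auto simp: C_def)
  have age: "induced LI I D \<in> Age LI I" if "finite D" "D \<subseteq> universe I" "D \<noteq> {}" for D
  proof -
    have "preserves_rels LI I D (\<lambda>x. x)"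
      using that by (simp add: preserves_rels_def)
    then show ?thesis
      using that substructure_induced[OF Funs that(2,3)] restrict_in_embeddings[OF Funs, of I D "\<lambda>x. x"]
      by (auto simp: Age_def substructure_def)
  qed
  define S where "S f = {j\<in>J. P j (map f (a j))}" for f
  \<comment> \<open>Colors are natural numbers, so the subsets of \<open>J\<close> are coded
    injectively.\<close>
  obtain code :: "_ set \<Rightarrow> nat" where code: "inj_on code (Pow J)"
    using finite_imp_inj_to_nat_seg[of "Pow J"] J by auto
  define c where "c f = code (S f)" for f
  have "c ` X \<subseteq> code ` Pow J" for X
    by (auto simp: c_def S_def)
  then have "finite (c ` X)" for X
    using J by (meson finite_Pow_iff finite_imageI finite_subset)
  then obtain \<iota> where \<iota>: "\<iota> \<in> embeddings LI (induced LI I C) I"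
    and mono: "\<And>f g. f \<in> embeddings LI (induced LI I B) I \<Longrightarrow> g \<in> embeddings LI (induced LI I B) I \<Longrightarrow>
      f ` B \<subseteq> \<iota> ` C \<Longrightarrow> g ` B \<subseteq> \<iota> ` C \<Longrightarrow> c f = c g"
    using ramsey age[OF B] age[OF C] unfolding ramsey_def by (metis universe_induced)
  have \<iota>_pres: "preserves_rels LI I C \<iota>"
    using \<iota> by (auto simp: preserves_rels_def embeddings_def)
  \<comment> \<open>Homogeneity extends the monochromatic copy of \<open>C\<close> to an
    automorphism of \<open>I\<close>.\<close>
  obtain \<sigma> where \<sigma>: "\<sigma> \<in> automorphisms LI I" "\<And>x. x \<in> C \<Longrightarrow> \<sigma> x = \<iota> x"
    using preserves_rels_extends[OF fh C \<iota>_pres] by blast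
  have "P j (map \<sigma> (a j)) \<longleftrightarrow> P j (map \<sigma> (map (\<rho> j) (a j)))" if j: "j \<in> J" for j
  proof -
    have aj: "set (a j) \<subseteq> B"
      using j by (auto simp: B_def)
    have \<rho>C: "\<rho> j ` B \<subseteq> C" "B \<subseteq> C"
      using j by (auto simp: C_def)
    have \<sigma>B: "preserves_rels LI I B \<sigma>"
      by (rule automorphism_preserves_rels[OF \<sigma>(1) B(2)])
    have \<rho>B: "preserves_rels LI I B (\<rho> j)"
      by (rule automorphism_preserves_rels[OF \<rho>[OF j] B(2)])
    have \<sigma>\<rho>B: "preserves_rels LI I (\<rho> j ` B) \<sigma>"
      by (rule automorphism_preserves_rels[OF \<sigma>(1) \<rho>_univ[OF j]])
    have "preserves_rels LI I B (\<sigma> \<circ> \<rho> j)"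
      using \<rho>B \<sigma>\<rho>B map_in_tuples[of _ B _ "\<rho> j" "\<rho> j ` B"]
      by (auto simp: preserves_rels_def comp_inj_on simp flip: map_map)
    moreover have "restrict \<sigma> B ` B \<subseteq> \<iota> ` C" "restrict (\<sigma> \<circ> \<rho> j) B ` B \<subseteq> \<iota> ` C"
      using \<rho>C \<sigma>(2) by (auto simp: subset_iff)
    \<comment> \<open>Both embeddings of \<open>B\<close> have image inside the copy of
      \<open>C\<close>, so their colors agree; in particular \<open>j\<close> lies in both color
      sets or in neither.\<close>
    ultimately have "c (restrict \<sigma> B) = c (restrict (\<sigma> \<circ> \<rho> j) B)"
      by (intro mono restrict_in_embeddings[OF Funs] \<sigma>B)
    then have "S (restrict \<sigma> B) = S (restrict (\<sigma> \<circ> \<rho> j) B)"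
      unfolding c_def by (rule inj_onD[OF code]) (auto simp: S_def)
    then have "P j (map (restrict \<sigma> B) (a j)) \<longleftrightarrow> P j (map (restrict (\<sigma> \<circ> \<rho> j) B) (a j))"
      using j by (auto simp: S_def)
    moreover have "map (restrict \<sigma> B) (a j) = map \<sigma> (a j)"
      "map (restrict (\<sigma> \<circ> \<rho> j) B) (a j) = map \<sigma> (map (\<rho> j) (a j))"
      using aj by auto
    ultimately show ?thesis
      by simp
  qed
  then show ?thesis
    using that \<sigma>(1) by blast
qed

text \<open>One formula in distinct variables for each relation symbol, and one equation. In a
  relational language all atomic formulas arise from these by substituting variables.\<close>

definition atomics :: "('g, 's) fo_language \<Rightarrow> ('g, 's) fo_formula set" where
  "atomics LI = insert (Equals (Var 0) (Var 1)) ((\<lambda>R. Rel R (map Var [0..<rarity LI R])) ` Rels LI)"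

lemma atomics_formula: "\<chi> \<in> atomics LI \<Longrightarrow> is_formula LI \<chi>"
  by (auto simp: atomics_def)

lemma finite_atomics: "finite (Rels LI) \<Longrightarrow> finite (atomics LI)"
  by (simp add: atomics_def)

text \<open>A common bound for the number of variables of the formulas in \<open>atomics\<close>, at
  least 2 because of the equation. With it, all of them can be evaluated on tuples of one
  length.\<close>

definition atomic_width :: "('g, 's) fo_language \<Rightarrow> nat" where
  "atomic_width LI = 2 + (\<Sum>R\<in>Rels LI. rarity LI R)"

lemma rarity_le_atomic_width:
  "finite (Rels LI) \<Longrightarrow> R \<in> Rels LI \<Longrightarrow> rarity LI R \<le> atomic_width LI"
  unfolding atomic_width_def by (meson member_le_sum trans_le_add2 zero_le)

lemma free_vars_atomics:
  assumes "finite (Rels LI)" "\<chi> \<in> atomics LI"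
  shows "free_vars \<chi> \<subseteq> {..<atomic_width LI}"
  using assms rarity_le_atomic_width[OF assms(1)]
  by (fastforce simp: atomics_def atomic_width_def)

text \<open>Agreement on atomic formulas makes the assignment of \<open>b ! p\<close> to
  \<open>a ! p\<close> a well-defined partial isomorphism, which homogeneity extends.\<close>

lemma atomically_equivalent_conjugate:
  assumes fh: "finitely_homogeneous LI I" and k: "0 < k"
    and a: "a \<in> tuples (universe I) k" and b: "b \<in> tuples (universe I) k"
    and eq: "\<And>\<chi> js. \<chi> \<in> atomics LI \<Longrightarrow> js \<in> tuples {..<k} (atomic_width LI) \<Longrightarrow>
      sat I (nth (map (nth a) js)) \<chi> \<longleftrightarrow> sat I (nth (map (nth b) js)) \<chi>"
  obtains \<sigma> where "\<sigma> \<in> automorphisms LI I" "map \<sigma> a = b"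
proof -
  have fin: "finite (Rels LI)"
    using fh by (simp add: finitely_homogeneous_def)
  have len: "length a = k" "length b = k"
    using a b by (auto simp: tuples_def)
  have eq_iff: "a ! p = a ! q \<longleftrightarrow> b ! p = b ! q" if "p < k" "q < k" for p q
  proof -
    \<comment> \<open>Position 0, which exists as \<open>0 < k\<close>, pads the list to the common
      length; the formula does not see the padding.\<close>
    define js where "js = p # q # replicate (atomic_width LI - 2) 0"
    have "js \<in> tuples {..<k} (atomic_width LI)"
      using that k by (auto simp: js_def tuples_def atomic_width_def)
    then show ?thesis
      using eq[of "Equals (Var 0) (Var 1)" js] by (simp add: atomics_def js_def)
  qed
  have rel_iff: "map (nth a) js \<in> rel_interp I R \<longleftrightarrow> map (nth b) js \<in> rel_interp I R"
    if "R \<in> Rels LI" "js \<in> tuples {..<k} (rarity LI R)" for R js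
  proof -
    define ks where "ks = js @ replicate (atomic_width LI - rarity LI R) 0"
    have js: "length js = rarity LI R"
      using that by (simp add: tuples_def)
    have "ks \<in> tuples {..<k} (atomic_width LI)"
      using that k rarity_le_atomic_width[OF fin that(1)] by (auto simp: ks_def tuples_def)
    then have *: "sat I (nth (map (nth a) ks)) (Rel R (map Var [0..<rarity LI R])) \<longleftrightarrow>
        sat I (nth (map (nth b) ks)) (Rel R (map Var [0..<rarity LI R]))"
      using that by (intro eq) (auto simp: atomics_def)
    have "map (eval_term I (nth (map (nth c) ks))) (map Var [0..<rarity LI R]) = map (nth c) js"
      for c
      using js by (intro nth_equalityI) (auto simp: ks_def nth_append)
    then show ?thesis
      using * by (simp only: sat.simps)
  qed
  \<comment> \<open>An entry may occur at several positions of \<open>a\<close>; by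
    \<open>eq_iff\<close> the choice among them does not affect the value.\<close>
  define h where "h x = b ! (SOME p. p < k \<and> a ! p = x)" for x
  have h: "h (a ! p) = b ! p" if "p < k" for p
  proof -
    have "(SOME q. q < k \<and> a ! q = a ! p) < k \<and> a ! (SOME q. q < k \<and> a ! q = a ! p) = a ! p"
      by (rule someI[of _ p]) (use that in simp)
    then show ?thesis
      using eq_iff that unfolding h_def by blast
  qed
  have set_a: "\<exists>p<k. x = a ! p" if "x \<in> set a" for x
    using that len by (metis in_set_conv_nth)
  have "preserves_rels LI I (set a) h"
    unfolding preserves_rels_def
  proof (intro conjI ballI)
    show "inj_on h (set a)"
      using set_a h eq_iff by (intro inj_onI) metis
    show "h ` set a \<subseteq> universe I"
      using set_a h b nth_mem[of _ b] by (fastforce simp: tuples_def)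
    fix R xs assume R: "R \<in> Rels LI" and xs: "xs \<in> tuples (set a) (rarity LI R)"
    then have "\<forall>x\<in>set xs. \<exists>p<k. x = a ! p"
      using set_a by (auto simp: tuples_def)
    then obtain pos where pos: "\<forall>x\<in>set xs. pos x < k \<and> x = a ! pos x"
      by metis
    then have "map pos xs \<in> tuples {..<k} (rarity LI R)" "xs = map (nth a) (map pos xs)"
      "map h xs = map (nth b) (map pos xs)"
      using xs h by (auto simp: tuples_def intro!: nth_equalityI) (metis nth_mem)+
    then show "xs \<in> rel_interp I R \<longleftrightarrow> map h xs \<in> rel_interp I R"
      using rel_iff[OF R] by metis
  qed
  moreover have "set a \<subseteq> universe I" "set a \<noteq> {}"
    using a k by (auto simp: tuples_def)
  ultimately obtain \<sigma> where \<sigma>: "\<sigma> \<in> automorphisms LI I" "\<And>x. x \<in> set a \<Longrightarrow> \<sigma> x = h x"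
    using preserves_rels_extends[OF fh finite_set] by blast
  then have "map \<sigma> a = b"
    using h len by (intro nth_equalityI) auto
  then show ?thesis
    using that \<sigma>(1) by blast
qed

lemma tp_empty_iff:
  "(\<phi>, []) \<in> tp L M {} xs \<longleftrightarrow> is_formula L \<phi> \<and> free_vars \<phi> \<subseteq> {..<length xs} \<and> sat M (nth xs) \<phi>"
  by (simp add: tp_def param_formulas_def holds_def)

text \<open>Renaming turns a formula about the subtuple at the positions \<open>js\<close> into one
  about the whole tuple, so equality of types passes to subtuples.\<close>

lemma tp_eq_sat_iff:
  assumes "tp L M {} a = tp L M {} b" "length a = length b" "is_formula L \<phi>"
    "free_vars \<phi> \<subseteq> {..<length js}" "set js \<subseteq> {..<length a}"
  shows "sat M (nth (map (nth a) js)) \<phi> \<longleftrightarrow> sat M (nth (map (nth b) js)) \<phi>"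
proof -
  have "sat M (nth c) (rename (nth js) \<phi>) \<longleftrightarrow> (rename (nth js) \<phi>, []) \<in> tp L M {} c"
    if "length c = length a" for c :: "'c list"
    using free_vars_rename_nth[OF assms(4)] assms that by (auto simp: tp_empty_iff)
  then show ?thesis
    using assms by (simp flip: sat_rename_nth)
qed

lemma tp_automorphism:
  assumes I: "is_structure L I" and \<sigma>: "\<sigma> \<in> automorphisms L I" and a: "set a \<subseteq> universe I"
  shows "tp L I {} (map \<sigma> a) = tp L I {} a"
proof -
  have "sat I (nth (map \<sigma> a)) \<phi> \<longleftrightarrow> sat I (nth a) \<phi>"
    if "is_formula L \<phi>" "free_vars \<phi> \<subseteq> {..<length a}" for \<phi>
    using \<sigma> I that a unfolding automorphisms_def by (intro sat_isomorphism_nth)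
  then show ?thesis
    by (auto simp: tp_def param_formulas_def holds_def)
qed

text \<open>The type of a tuple records the atomic formulas true of all its subtuples, so
  homogeneity applies: types are orbits.\<close>

lemma tp_eq_conjugate:
  assumes fh: "finitely_homogeneous LI I" and k: "0 < k"
    and a: "a \<in> tuples (universe I) k" and b: "b \<in> tuples (universe I) k"
    and tp: "tp LI I {} a = tp LI I {} b"
  obtains \<sigma> where "\<sigma> \<in> automorphisms LI I" "map \<sigma> a = b"
proof (rule atomically_equivalent_conjugate[OF fh k a b])
  fix \<chi> js assume "\<chi> \<in> atomics LI" "js \<in> tuples {..<k} (atomic_width LI)"
  then show "sat I (nth (map (nth a) js)) \<chi> \<longleftrightarrow> sat I (nth (map (nth b) js)) \<chi>"
    using tp a b fh free_vars_atomics[of LI \<chi>]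
    by (intro tp_eq_sat_iff[of LI]) (auto simp: tuples_def atomics_formula finitely_homogeneous_def)
qed (use that in blast)

text \<open>Quantifier elimination in the form needed here: atomically equivalent tuples are
  conjugate, and automorphisms preserve types.\<close>

lemma atomically_equivalent_tp_eq:
  assumes fh: "finitely_homogeneous LI I" and k: "0 < k"
    and a: "a \<in> tuples (universe I) k" and b: "b \<in> tuples (universe I) k"
    and eq: "\<And>\<chi> js. \<chi> \<in> atomics LI \<Longrightarrow> js \<in> tuples {..<k} (atomic_width LI) \<Longrightarrow>
      sat I (nth (map (nth a) js)) \<chi> \<longleftrightarrow> sat I (nth (map (nth b) js)) \<chi>"
  shows "tp LI I {} a = tp LI I {} b"
proof -
  obtain \<sigma> where "\<sigma> \<in> automorphisms LI I" "map \<sigma> a = b"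
    using atomically_equivalent_conjugate[OF assms] .
  then show ?thesis
    using tp_automorphism[of LI I \<sigma> a] fh a by (auto simp: finitely_homogeneous_def tuples_def)
qed

text \<open>The type of \<open>a\<close> depends only on \<open>d a\<close>, a subset of the finite
  set \<open>F\<close> of atomic conditions on positions.\<close>

lemma finite_types:
  assumes fh: "finitely_homogeneous LI I" and k: "0 < k"
  shows "finite (tp LI I {} ` tuples (universe I) k)"
proof -
  define F where "F = atomics LI \<times> tuples {..<k} (atomic_width LI)"
  define d where "d a = {(\<chi>, js)\<in>F. sat I (nth (map (nth a) js)) \<chi>}" for a
  have "finite (tuples {..<k} n)" for n
    using finite_lists_length_eq[of "{..<k}" n] by (simp add: tuples_def conj_commute)
  then have "finite F"
    using fh by (auto simp: F_def finitely_homogeneous_def finite_atomics)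
  moreover have "d ` tuples (universe I) k \<subseteq> Pow F"
    by (auto simp: d_def)
  ultimately have "finite (d ` tuples (universe I) k)"
    by (meson finite_Pow_iff finite_subset)
  moreover have "tp LI I {} a = tp LI I {} b"
    if "a \<in> tuples (universe I) k" "b \<in> tuples (universe I) k" "d a = d b" for a b
    using that(3) by (intro atomically_equivalent_tp_eq[OF fh k that(1,2)]) (auto simp: d_def F_def)
  \<comment> \<open>The type factors through \<open>d\<close>: \<open>g\<close> takes the type of
    any tuple with the given value of \<open>d\<close>.\<close>
  then have "\<exists>g. \<forall>a\<in>tuples (universe I) k. tp LI I {} a = g (d a)"
    by (intro exI[of _ "\<lambda>D. tp LI I {} (SOME a. a \<in> tuples (universe I) k \<and> d a = D)"])
      (metis (mono_tags, lifting) someI)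
  then obtain g where "\<forall>a\<in>tuples (universe I) k. tp LI I {} a = g (d a)" ..
  then have "tp LI I {} ` tuples (universe I) k = g ` d ` tuples (universe I) k"
    by (auto simp: image_iff)
  ultimately show ?thesis
    by simp
qed

section \<open>Trace definitions from uncollapsed indiscernible pictures\<close>

lemma nth_concat_uniform:
  "(\<And>x. x \<in> set xs \<Longrightarrow> length x = m) \<Longrightarrow> q < length xs \<Longrightarrow> r < m \<Longrightarrow>
    concat xs ! (q * m + r) = xs ! q ! r"
proof (induction xs arbitrary: q)
  case (Cons x xs)
  then show ?case
    by (cases q) (auto simp: nth_append add.assoc)
qed simp

lemma length_concat_uniform:
  "(\<And>x. x \<in> set xs \<Longrightarrow> length x = m) \<Longrightarrow> length (concat xs) = length xs * m"
  by (induction xs) auto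

lemma concat_in_tuples:
  assumes "\<gamma> \<in> U \<rightarrow> tuples V m" "a \<in> tuples U k"
  shows "concat (map \<gamma> a) \<in> tuples V (k * m)"
proof -
  have *: "\<gamma> x \<in> tuples V m" if "x \<in> set a" for x
    using assms that by (auto simp: tuples_def)
  then have "length (concat (map \<gamma> a)) = k * m"
    using assms(2) by (subst length_concat_uniform[of _ m]) (auto simp: tuples_def)
  then show ?thesis
    using * by (auto simp: tuples_def)
qed

text \<open>The positions that the entries with indices \<open>js\<close> of a tuple occupy in its
  concatenated image, if each entry contributes \<open>m\<close> coordinates.\<close>

definition blocks :: "nat \<Rightarrow> nat list \<Rightarrow> nat list" where
  "blocks m js = concat (map (\<lambda>q. [q * m..<q * m + m]) js)"

lemma length_blocks [simp]: "length (blocks m js) = length js * m"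
  by (induction js) (auto simp: blocks_def)

lemma set_blocks:
  assumes "set js \<subseteq> {..<k}"
  shows "set (blocks m js) \<subseteq> {..<k * m}"
proof
  fix i assume "i \<in> set (blocks m js)"
  then obtain q where "q < k" "i < q * m + m"
    using assms by (auto simp: blocks_def)
  moreover have "Suc q * m \<le> k * m"
    using \<open>q < k\<close> by (intro mult_right_mono) auto
  ultimately show "i \<in> {..<k * m}"
    by auto
qed

lemma map_upt_offset: "map v [d..<d + m] = map (\<lambda>r. v (d + r)) [0..<m]"
  by (rule nth_equalityI) auto

lemma map_blocks:
  "map v (blocks m js) = concat (map (\<lambda>q. map (\<lambda>r. v (q * m + r)) [0..<m]) js)"
  by (induction js) (auto simp: blocks_def map_upt_offset)

lemma map_nth_blocks:
  assumes "\<gamma> \<in> U \<rightarrow> tuples V m" "a \<in> tuples U k" "set js \<subseteq> {..<k}"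
  shows "map (nth (concat (map \<gamma> a) @ ys)) (blocks m js) = concat (map \<gamma> (map (nth a) js))"
proof -
  have len: "length (\<gamma> x) = m" if "x \<in> set a" for x
    using assms that by (auto simp: tuples_def)
  have k: "length a = k" "length (concat (map \<gamma> a)) = k * m"
    using assms(2) concat_in_tuples[OF assms(1,2)] by (auto simp: tuples_def)
  have "map (\<lambda>r. (concat (map \<gamma> a) @ ys) ! (q * m + r)) [0..<m] = \<gamma> (a ! q)"
    if "q \<in> set js" for q
  proof -
    have q: "q < k" "length (\<gamma> (a ! q)) = m"
      using that assms(3) k len by auto
    have "(concat (map \<gamma> a) @ ys) ! (q * m + r) = \<gamma> (a ! q) ! r" if "r < m" for r
    proof -
      \<comment> \<open>The index stays below \<open>k * m\<close>, so it falls into the image of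
        \<open>a\<close> and not into the tail \<open>ys\<close>.\<close>
      have "q * m + r < Suc q * m"
        using that by simp
      also have "Suc q * m \<le> k * m"
        using q(1) by (intro mult_right_mono) auto
      finally show ?thesis
        using nth_concat_uniform[of "map \<gamma> a" m q r] k q that len by (auto simp: nth_append)
    qed
    then show ?thesis
      using q(2) by (intro nth_equalityI) auto
  qed
  then have "map (\<lambda>q. map (\<lambda>r. (concat (map \<gamma> a) @ ys) ! (q * m + r)) [0..<m]) js = map (\<lambda>q. \<gamma> (a ! q)) js"
    by (intro map_cong) auto
  then show ?thesis
    by (simp add: map_blocks comp_def del: map_eq_conv)
qed

lemma map_nth_append_upt: "map (nth (xs @ ys)) [length xs..<length xs + length ys] = ys"
  by (rule nth_equalityI) auto

lemma tp_eq_holds_iff: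
  assumes "tp L M A xs = tp L M A ys" "length xs = n" "length ys = n" "p \<in> param_formulas L A n"
  shows "holds M xs p \<longleftrightarrow> holds M ys p"
  using assms by (auto simp: tp_def)

text \<open>The counterpart of \<open>tp_eq_sat_iff\<close> for images of tuples and for types over
  \<open>A\<close>: variables are renamed block by block and the parameters are kept.\<close>

lemma tp_eq_subtuple:
  assumes \<gamma>: "\<gamma> \<in> U \<rightarrow> tuples V m" and a: "a \<in> tuples U k" and b: "b \<in> tuples U k"
    and tp: "tp L M A (concat (map \<gamma> a)) = tp L M A (concat (map \<gamma> b))"
    and js: "js \<in> tuples {..<k} n" and p: "p \<in> param_formulas L A (n * m)"
  shows "holds M (concat (map \<gamma> (map (nth a) js))) p \<longleftrightarrow> holds M (concat (map \<gamma> (map (nth b) js))) p"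
proof -
  obtain \<phi> cs where \<phi>: "p = (\<phi>, cs)"
    by (cases p)
  \<comment> \<open>The parameters keep their order, but their variables now begin at
    \<open>k * m\<close> instead of \<open>n * m\<close>.\<close>
  define ks where "ks = blocks m js @ [k * m..<k * m + length cs]"
  have fv: "free_vars \<phi> \<subseteq> {..<length ks}"
    using p js by (auto simp: \<phi> param_formulas_def ks_def tuples_def)
  have "set (blocks m js) \<subseteq> {..<k * m}"
    using js by (intro set_blocks) (auto simp: tuples_def)
  then have "set ks \<subseteq> {..<k * m + length cs}"
    by (auto simp: ks_def)
  then have q: "(rename (nth ks) \<phi>, cs) \<in> param_formulas L A (k * m)"
    using p free_vars_rename_nth[OF fv] by (auto simp: \<phi> param_formulas_def)
  have "holds M (concat (map \<gamma> (map (nth c) js))) p \<longleftrightarrow>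
      holds M (concat (map \<gamma> c)) (rename (nth ks) \<phi>, cs)" if c: "c \<in> tuples U k" for c
  proof -
    have len: "length (concat (map \<gamma> c)) = k * m"
      using concat_in_tuples[OF \<gamma> c] by (simp add: tuples_def)
    have "map (nth (concat (map \<gamma> c) @ cs)) ks = concat (map \<gamma> (map (nth c) js)) @ cs"
      using map_nth_blocks[OF \<gamma> c, of js cs] js map_nth_append_upt[of "concat (map \<gamma> c)" cs] len
      by (simp add: ks_def tuples_def)
    then show ?thesis
      by (simp add: holds_def \<phi> sat_rename_nth[OF fv])
  qed
  moreover have "holds M (concat (map \<gamma> a)) (rename (nth ks) \<phi>, cs) \<longleftrightarrow>
      holds M (concat (map \<gamma> b)) (rename (nth ks) \<phi>, cs)"
    using tp concat_in_tuples[OF \<gamma> a] concat_in_tuples[OF \<gamma> b] q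
    by (intro tp_eq_holds_iff[of L M A _ _ "k * m"]) (auto simp: tuples_def)
  ultimately show ?thesis
    using a b by blast
qed

section \<open>The Boolean algebra of sets definable over \<open>A\<close>, and separation\<close>

definition definable_over ::
  "('f, 'r) fo_language \<Rightarrow> ('f, 'r, 'a) fo_structure \<Rightarrow> 'a set \<Rightarrow> nat \<Rightarrow> 'a list set \<Rightarrow> bool" where
  "definable_over L M A n Z \<longleftrightarrow>
     (\<exists>p\<in>param_formulas L A n. Z = {xs \<in> tuples (universe M) n. holds M xs p})"

lemma definable_over_Diff:
  assumes "definable_over L M A n Z"
  shows "definable_over L M A n (tuples (universe M) n - Z)"
proof -
  obtain \<phi> cs where "(\<phi>, cs) \<in> param_formulas L A n" "Z = {xs \<in> tuples (universe M) n. holds M xs (\<phi>, cs)}"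
    using assms by (auto simp: definable_over_def)
  then show ?thesis
    unfolding definable_over_def
    by (intro bexI[of _ "(Neg \<phi>, cs)"]) (auto simp: param_formulas_def holds_def)
qed

lemma definable_over_Int:
  assumes "definable_over L M A n Z" "definable_over L M A n Z'"
  shows "definable_over L M A n (Z \<inter> Z')"
proof -
  obtain \<phi> cs where \<phi>: "(\<phi>, cs) \<in> param_formulas L A n"
    and Z: "Z = {xs \<in> tuples (universe M) n. holds M xs (\<phi>, cs)}"
    using assms by (auto simp: definable_over_def)
  obtain \<psi> ds where \<psi>: "(\<psi>, ds) \<in> param_formulas L A n"
    and Z': "Z' = {xs \<in> tuples (universe M) n. holds M xs (\<psi>, ds)}"
    using assms by (auto simp: definable_over_def)
  \<comment> \<open>In the joint parameter list \<open>cs @ ds\<close> the parameters of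
    \<open>\<psi>\<close> come after those of \<open>\<phi>\<close>, so their variables are shifted
    by \<open>length cs\<close>.\<close>
  define js where "js = [0..<n] @ [n + length cs..<n + length cs + length ds]"
  have fv: "free_vars \<psi> \<subseteq> {..<length js}"
    using \<psi> by (auto simp: param_formulas_def js_def)
  have "set js \<subseteq> {..<n + length (cs @ ds)}"
    by (auto simp: js_def)
  moreover have "free_vars \<phi> \<subseteq> {..<n + length (cs @ ds)}"
    using \<phi> by (auto simp: param_formulas_def)
  ultimately have "(Conj \<phi> (rename (nth js) \<psi>), cs @ ds) \<in> param_formulas L A n"
    using \<phi> \<psi> free_vars_rename_nth[OF fv] by (auto simp: param_formulas_def)
  moreover have "holds M xs (Conj \<phi> (rename (nth js) \<psi>), cs @ ds) \<longleftrightarrow>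
      holds M xs (\<phi>, cs) \<and> holds M xs (\<psi>, ds)" if "length xs = n" for xs
  proof -
    have "sat M (nth (xs @ cs @ ds)) \<phi> \<longleftrightarrow> sat M (nth (xs @ cs)) \<phi>"
      using \<phi> that by (intro sat_cong) (auto simp: param_formulas_def nth_append)
    moreover have "map (nth (xs @ cs @ ds)) js = xs @ ds"
      using that by (intro nth_equalityI) (auto simp: js_def nth_append)
    ultimately show ?thesis
      by (simp add: holds_def sat_rename_nth[OF fv])
  qed
  ultimately show ?thesis
    unfolding definable_over_def Z Z' by (intro bexI) (auto simp: tuples_def)
qed

lemma definable_over_tuples:
  assumes "is_structure L M"
  shows "definable_over L M A n (tuples (universe M) n)"
  unfolding definable_over_def using assms
  \<comment> \<open>The tautology has no free variables, so that \<open>n = 0\<close> is covered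
    too.\<close>
  by (intro bexI[of _ "(Exists 0 (Equals (Var 0) (Var 0)), [])"])
    (auto simp: param_formulas_def holds_def is_structure_def)

text \<open>Pairwise separation suffices for finite families: for fixed \<open>s\<close> the
  separating sets are intersected over \<open>S'\<close>, and the results are united over
  \<open>S\<close>, the union being expressed by complements and intersections.\<close>

lemma definable_over_separation:
  fixes M :: "('f, 'r, 'a) fo_structure"
  assumes M: "is_structure L M" and S: "finite S" and S': "finite S'"
    and G: "\<And>s. s \<in> S \<Longrightarrow> G s \<subseteq> tuples (universe M) n"
    and sep: "\<And>s t. s \<in> S \<Longrightarrow> t \<in> S' \<Longrightarrow> \<exists>Z. definable_over L M A n Z \<and> G s \<subseteq> Z \<and> G t \<inter> Z = {}"
  shows "\<exists>Z. definable_over L M A n Z \<and> (\<forall>s\<in>S. G s \<subseteq> Z) \<and> (\<forall>t\<in>S'. G t \<inter> Z = {})"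
proof -
  have single: "\<exists>Z. definable_over L M A n Z \<and> G s \<subseteq> Z \<and> (\<forall>t\<in>S'. G t \<inter> Z = {})"
    if s: "s \<in> S" for s
    using S' sep[OF s]
  proof (induction S')
    case empty
    show ?case
      using definable_over_tuples[OF M] G[OF s] by blast
  next
    case (insert t F)
    obtain Z where Z: "definable_over L M A n Z" "G s \<subseteq> Z" "\<forall>t\<in>F. G t \<inter> Z = {}"
      using insert.IH insert.prems by auto
    obtain Z' where Z': "definable_over L M A n Z'" "G s \<subseteq> Z'" "G t \<inter> Z' = {}"
      using insert.prems[of t] by auto
    show ?case
      using definable_over_Int[OF Z(1) Z'(1)] Z Z' by (intro exI[of _ "Z \<inter> Z'"]) auto
  qed
  show ?thesis
    using S single
  proof (induction S)
    case empty
    show ?case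
      using definable_over_Diff[OF definable_over_tuples[OF M, of A n]] by (intro exI[of _ "{}"]) auto
  next
    case (insert s F)
    obtain Z where Z: "definable_over L M A n Z" "\<forall>s\<in>F. G s \<subseteq> Z" "\<forall>t\<in>S'. G t \<inter> Z = {}"
      using insert.IH insert.prems by auto
    obtain Z' where Z': "definable_over L M A n Z'" "G s \<subseteq> Z'" "\<forall>t\<in>S'. G t \<inter> Z' = {}"
      using insert.prems[of s] by auto
    have sub: "Z \<subseteq> tuples (universe M) n" "Z' \<subseteq> tuples (universe M) n"
      using Z(1) Z'(1) by (auto simp: definable_over_def)
    let ?T = "tuples (universe M) n"
    have "definable_over L M A n (?T - ((?T - Z) \<inter> (?T - Z')))"
      using Z(1) Z'(1) by (intro definable_over_Diff definable_over_Int)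
    moreover have "?T - ((?T - Z) \<inter> (?T - Z')) = Z \<union> Z'"
      using sub by auto
    ultimately have "definable_over L M A n (Z \<union> Z')"
      by simp
    then show ?case
      using Z Z' by (intro exI[of _ "Z \<union> Z'"]) auto
  qed
qed

text \<open>The parameters \<open>cs\<close> of \<open>X\<close> are first appended to the
  variables, so that membership depends only on the type of an \<open>n\<close>-tuple over the empty
  set. After separation over \<open>A\<close>, the images of \<open>cs\<close> are frozen as
  additional parameters.\<close>

lemma uncollapsed_indiscernible_trace_definition:
  assumes fh: "finitely_homogeneous LI I" and M: "is_structure L M"
    and \<gamma>: "picture I M m \<gamma>" and A: "A \<subseteq> universe M"
    and ind: "indiscernible_picture LI I L M A \<gamma>" and unc: "uncollapsed_picture LI I L M A \<gamma>"
  shows "trace_definition LI I L M m \<gamma>"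
proof -
  have \<gamma>_fun: "\<gamma> \<in> universe I \<rightarrow> tuples (universe M) m"
    using \<gamma> by (simp add: picture_def)
  have "\<exists>Y. definable L M (k * m) Y \<and> X = {xs \<in> tuples (universe I) k. concat (map \<gamma> xs) \<in> Y}"
    if k: "k \<ge> 1" and X: "definable LI I k X" for k X
  proof -
    obtain \<chi> cs where \<chi>: "(\<chi>, cs) \<in> param_formulas LI (universe I) k"
      and X_eq: "X = {xs \<in> tuples (universe I) k. holds I xs (\<chi>, cs)}"
      using X by (auto simp: definable_def)
    define n where "n = k + length cs"
    let ?In = "tuples (universe I) n"
    define G where "G t = (\<lambda>a. concat (map \<gamma> a)) ` {a\<in>?In. tp LI I {} a = t}" for t
    define S where "S b = tp LI I {} ` {a\<in>?In. sat I (nth a) \<chi> = b}" for b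
    have n: "n \<ge> 1"
      using k by (simp add: n_def)
    have G_tuples: "G t \<subseteq> tuples (universe M) (n * m)" for t
      using concat_in_tuples[OF \<gamma>_fun] by (auto simp: G_def)
    have "finite (S b)" for b
      using finite_types[OF fh, of n] n by (auto simp: S_def elim: finite_subset[rotated])
    moreover have "\<exists>Z. definable_over L M A (n * m) Z \<and> G s \<subseteq> Z \<and> G t \<inter> Z = {}"
      if s: "s \<in> S True" and t: "t \<in> S False" for s t
    proof -
      obtain a where a: "a \<in> ?In" "sat I (nth a) \<chi>" "s = tp LI I {} a"
        using s by (auto simp: S_def)
      obtain b where b: "b \<in> ?In" "\<not> sat I (nth b) \<chi>" "t = tp LI I {} b"
        using t by (auto simp: S_def)
      have "(\<chi>, []) \<in> tp LI I {} a" "(\<chi>, []) \<notin> tp LI I {} b"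
        using a b \<chi> by (auto simp: tp_empty_iff tuples_def param_formulas_def n_def)
      then have "tp LI I {} a \<noteq> tp LI I {} b"
        by blast
      \<comment> \<open>The tuples have different types because \<open>\<chi>\<close> distinguishes
        them; being uncollapsed, the picture then has a formula over \<open>A\<close> that tells
        their images apart.\<close>
      then have "tp L M A (concat (map \<gamma> a)) \<noteq> tp L M A (concat (map \<gamma> b))"
        using unc n a(1) b(1) unfolding uncollapsed_picture_def by blast
      moreover have len: "length (concat (map \<gamma> c)) = n * m" if "c \<in> ?In" for c
        using concat_in_tuples[OF \<gamma>_fun that] by (simp add: tuples_def)
      ultimately obtain p where p: "p \<in> param_formulas L A (n * m)"
        "holds M (concat (map \<gamma> a)) p \<noteq> holds M (concat (map \<gamma> b)) p"
        using a(1) b(1) by (auto simp: tp_def)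
      \<comment> \<open>By indiscernibility the truth value of \<open>p\<close> depends only on the
        type in \<open>I\<close>, so it is constant on \<open>G s\<close> and on
        \<open>G t\<close>.\<close>
      have inv: "holds M (concat (map \<gamma> c)) p = holds M (concat (map \<gamma> d)) p"
        if c: "c \<in> ?In" and d: "d \<in> ?In" and cd: "tp LI I {} c = tp LI I {} d" for c d
        using ind n c d cd p(1) len[OF c] len[OF d] unfolding indiscernible_picture_def
        by (intro tp_eq_holds_iff[of L M A _ _ "n * m"]) blast+
      have Gs: "holds M z p = holds M (concat (map \<gamma> a)) p" if "z \<in> G s" for z
      proof -
        from that obtain c where c: "z = concat (map \<gamma> c)" "c \<in> ?In" "tp LI I {} c = s"
          by (auto simp: G_def)
        show ?thesis
          unfolding c(1) using a c by (intro inv) auto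
      qed
      have Gt: "holds M z p = holds M (concat (map \<gamma> b)) p" if "z \<in> G t" for z
      proof -
        from that obtain c where c: "z = concat (map \<gamma> c)" "c \<in> ?In" "tp LI I {} c = t"
          by (auto simp: G_def)
        show ?thesis
          unfolding c(1) using b c by (intro inv) auto
      qed
      define Z where "Z = {xs \<in> tuples (universe M) (n * m). holds M xs p}"
      have Z: "definable_over L M A (n * m) Z"
        using p(1) by (auto simp: definable_over_def Z_def)
      show ?thesis
      \<comment> \<open>The formula \<open>p\<close> may be true on either side; if it is true on
        \<open>G t\<close>, the complement separates.\<close>
      proof (cases "holds M (concat (map \<gamma> a)) p")
        case True
        then have "G s \<subseteq> Z" "G t \<inter> Z = {}"
          using Gs Gt p(2) G_tuples[of s] by (auto simp: Z_def)
        then show ?thesis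
          using Z by blast
      next
        case False
        then have "G s \<subseteq> tuples (universe M) (n * m) - Z" "G t \<inter> (tuples (universe M) (n * m) - Z) = {}"
          using Gs Gt p(2) G_tuples[of s] G_tuples[of t] by (auto simp: Z_def)
        then show ?thesis
          using definable_over_Diff[OF Z] by blast
      qed
    qed
    ultimately obtain Z where Z: "definable_over L M A (n * m) Z"
      "\<forall>s\<in>S True. G s \<subseteq> Z" "\<forall>t\<in>S False. G t \<inter> Z = {}"
      using definable_over_separation[OF M, of "S True" "S False" G "n * m" A] G_tuples by auto
    obtain \<psi> ds where \<psi>: "(\<psi>, ds) \<in> param_formulas L A (n * m)"
      and Z_eq: "Z = {xs \<in> tuples (universe M) (n * m). holds M xs (\<psi>, ds)}"
      using Z(1) by (auto simp: definable_over_def)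
    define es where "es = concat (map \<gamma> cs)"
    have cs: "cs \<in> tuples (universe I) (length cs)"
      using \<chi> by (auto simp: tuples_def param_formulas_def)
    have es: "es \<in> tuples (universe M) (length cs * m)"
      unfolding es_def by (rule concat_in_tuples[OF \<gamma>_fun cs])
    \<comment> \<open>The image of \<open>xs @ cs\<close> has the blocks of \<open>cs\<close>
      directly behind those of \<open>xs\<close>, so \<open>es\<close> precedes \<open>ds\<close>
      among the parameters.\<close>
    define Y where "Y = {ys \<in> tuples (universe M) (k * m). holds M ys (\<psi>, es @ ds)}"
    have "(\<psi>, es @ ds) \<in> param_formulas L (universe M) (k * m)"
      using \<psi> A es by (auto simp: param_formulas_def tuples_def n_def algebra_simps)
    then have "definable L M (k * m) Y"
      by (auto simp: definable_def Y_def)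
    moreover have "holds I xs (\<chi>, cs) \<longleftrightarrow> concat (map \<gamma> xs) \<in> Y" if xs: "xs \<in> tuples (universe I) k" for xs
    proof -
      have In: "xs @ cs \<in> ?In"
        using xs cs by (auto simp: tuples_def n_def)
      have "concat (map \<gamma> xs) \<in> Y \<longleftrightarrow> concat (map \<gamma> (xs @ cs)) \<in> Z"
        using concat_in_tuples[OF \<gamma>_fun xs] concat_in_tuples[OF \<gamma>_fun In]
        by (simp add: Y_def Z_eq holds_def es_def)
      moreover have "concat (map \<gamma> (xs @ cs)) \<in> G (tp LI I {} (xs @ cs))"
        unfolding G_def using In by blast
      moreover have "tp LI I {} (xs @ cs) \<in> S (holds I xs (\<chi>, cs))"
        using In by (auto simp: S_def holds_def)
      ultimately show ?thesis
        using Z(2,3) by (cases "holds I xs (\<chi>, cs)") auto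
    qed
    ultimately show ?thesis
      unfolding X_eq by blast
  qed
  then show ?thesis
    using \<gamma>_fun unfolding trace_definition_def by blast
qed

section \<open>Pictures from trace definitions\<close>

lemma definable_no_params:
  assumes "is_formula L \<chi>" "free_vars \<chi> \<subseteq> {..<k}"
  shows "definable L M k {xs \<in> tuples (universe M) k. sat M (nth xs) \<chi>}"
  unfolding definable_def using assms
  by (intro bexI[of _ "(\<chi>, [])"]) (auto simp: param_formulas_def holds_def)

lemma subset_image_list:
  assumes "set cs \<subseteq> f ` A"
  obtains ks where "set ks \<subseteq> A" "map f ks = cs"
proof -
  have "cs \<in> map f ` lists A"
    using assms by (simp add: in_lists_conv_set subset_iff flip: lists_image)
  then show ?thesis
    using that by (auto simp: in_lists_conv_set subset_iff)
qed

text \<open>All parameters of the finitely many tracing formulas are gathered in one list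
  \<open>d\<close> and addressed by position, so that variables can take their place when another
  model is used.\<close>

lemma trace_definition_atomic_formulas:
  assumes fh: "finitely_homogeneous LI I" and td: "trace_definition LI I L N m \<tau>"
  obtains d \<psi> js where "set d \<subseteq> universe N"
    and "\<And>\<chi>. \<chi> \<in> atomics LI \<Longrightarrow>
      is_formula L (\<psi> \<chi>) \<and> set (js \<chi>) \<subseteq> {..<length d} \<and>
      free_vars (\<psi> \<chi>) \<subseteq> {..<atomic_width LI * m + length (js \<chi>)}"
    and "\<And>\<chi> c. \<chi> \<in> atomics LI \<Longrightarrow> c \<in> tuples (universe I) (atomic_width LI) \<Longrightarrow>
      sat I (nth c) \<chi> \<longleftrightarrow> sat N (nth (concat (map \<tau> c) @ map (nth d) (js \<chi>))) (\<psi> \<chi>)"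
proof -
  let ?K = "atomic_width LI"
  have fin: "finite (Rels LI)"
    using fh by (simp add: finitely_homogeneous_def)
  have \<tau>: "\<tau> \<in> universe I \<rightarrow> tuples (universe N) m"
    using td by (simp add: trace_definition_def)
  have "\<exists>p. p \<in> param_formulas L (universe N) (?K * m) \<and>
      (\<forall>c\<in>tuples (universe I) ?K. sat I (nth c) \<chi> \<longleftrightarrow> holds N (concat (map \<tau> c)) p)"
    if \<chi>: "\<chi> \<in> atomics LI" for \<chi>
  proof -
    have "definable LI I ?K {xs \<in> tuples (universe I) ?K. sat I (nth xs) \<chi>}"
      using \<chi> fin by (intro definable_no_params atomics_formula free_vars_atomics)
    moreover have "?K \<ge> 1"
      by (simp add: atomic_width_def)
    ultimately obtain Y where Y: "definable L N (?K * m) Y"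
      "{xs \<in> tuples (universe I) ?K. sat I (nth xs) \<chi>} = {xs \<in> tuples (universe I) ?K. concat (map \<tau> xs) \<in> Y}"
      using td unfolding trace_definition_def by meson
    then obtain p where p: "p \<in> param_formulas L (universe N) (?K * m)"
      "Y = {xs \<in> tuples (universe N) (?K * m). holds N xs p}"
      by (auto simp: definable_def)
    have "sat I (nth c) \<chi> \<longleftrightarrow> holds N (concat (map \<tau> c)) p" if "c \<in> tuples (universe I) ?K" for c
      using Y(2) p(2) that concat_in_tuples[OF \<tau> that] by blast
    then show ?thesis
      using p(1) by blast
  qed
  then obtain P where P: "\<And>\<chi>. \<chi> \<in> atomics LI \<Longrightarrow> P \<chi> \<in> param_formulas L (universe N) (?K * m)"
    "\<And>\<chi> c. \<chi> \<in> atomics LI \<Longrightarrow> c \<in> tuples (universe I) ?K \<Longrightarrow>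
       sat I (nth c) \<chi> \<longleftrightarrow> holds N (concat (map \<tau> c)) (P \<chi>)"
    by metis
  define D where "D = (\<Union>\<chi>\<in>atomics LI. set (snd (P \<chi>)))"
  have "finite D"
    using finite_atomics[OF fin] by (simp add: D_def)
  then obtain d where d: "set d = D"
    using finite_list by blast
  have "\<exists>js. set js \<subseteq> {..<length d} \<and> map (nth d) js = snd (P \<chi>)" if "\<chi> \<in> atomics LI" for \<chi>
  proof -
    have "set d = nth d ` {..<length d}"
      by (auto simp: set_conv_nth)
    then have "set (snd (P \<chi>)) \<subseteq> nth d ` {..<length d}"
      using that d by (auto simp: D_def)
    then show ?thesis
      by (rule subset_image_list) blast
  qed
  then obtain js where js: "\<And>\<chi>. \<chi> \<in> atomics LI \<Longrightarrow> set (js \<chi>) \<subseteq> {..<length d}"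
    "\<And>\<chi>. \<chi> \<in> atomics LI \<Longrightarrow> map (nth d) (js \<chi>) = snd (P \<chi>)"
    by metis
  show ?thesis
  proof (rule that[of d "\<lambda>\<chi>. fst (P \<chi>)" js])
    show "set d \<subseteq> universe N"
      using P(1) by (fastforce simp: d D_def param_formulas_def)
  next
    fix \<chi> assume \<chi>: "\<chi> \<in> atomics LI"
    have "length (js \<chi>) = length (snd (P \<chi>))"
      using js(2)[OF \<chi>] by (metis length_map)
    then show "is_formula L (fst (P \<chi>)) \<and> set (js \<chi>) \<subseteq> {..<length d} \<and>
        free_vars (fst (P \<chi>)) \<subseteq> {..<?K * m + length (js \<chi>)}"
      using P(1)[OF \<chi>] js(1)[OF \<chi>] by (auto simp: param_formulas_def)
    fix c assume "c \<in> tuples (universe I) ?K"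
    then show "sat I (nth c) \<chi> \<longleftrightarrow> sat N (nth (concat (map \<tau> c) @ map (nth d) (js \<chi>))) (fst (P \<chi>))"
      using P(2)[OF \<chi>] js(2)[OF \<chi>] by (simp add: holds_def case_prod_beta)
  qed
qed

text \<open>
  The variables \<open>0, \<dots>, D - 1\<close> stand for parameters, and each element of \<open>I\<close> has its own block of
  \<open>m\<close> variables behind them.
\<close>

definition point_vars :: "nat \<Rightarrow> nat \<Rightarrow> 'i set \<Rightarrow> 'i \<Rightarrow> nat list" where
  "point_vars D m U x = [D + to_nat_on U x * m..<D + to_nat_on U x * m + m]"

text \<open>The assertion of \<open>\<phi>\<close> about the image of \<open>a\<close>, with the
  parameters read from the variables \<open>js\<close>.\<close>

definition tuple_formula ::
  "nat \<Rightarrow> nat \<Rightarrow> 'i set \<Rightarrow> 'i list \<Rightarrow> nat list \<Rightarrow> ('f, 'r) fo_formula \<Rightarrow> ('f, 'r) fo_formula" where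
  "tuple_formula D m U a js \<phi> = rename (nth (concat (map (point_vars D m U) a) @ js)) \<phi>"

lemma length_point_vars [simp]: "length (point_vars D m U x) = m"
  by (simp add: point_vars_def)

lemma sat_tuple_formula:
  assumes "free_vars \<phi> \<subseteq> {..<length a * m + length js}"
  shows "sat M v (tuple_formula D m U a js \<phi>) \<longleftrightarrow>
    sat M (nth (concat (map (\<lambda>x. map v (point_vars D m U x)) a) @ map v js)) \<phi>"
proof -
  have len: "length (concat (map (point_vars D m U) a)) = length a * m"
    by (induction a) auto
  have "map v (concat (map (point_vars D m U) a)) = concat (map (\<lambda>x. map v (point_vars D m U x)) a)"
    by (simp add: map_concat comp_def)
  then show ?thesis
    unfolding tuple_formula_def using assms len by (subst sat_rename_nth) auto
qed

lemma assignment_exists: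
  assumes U: "countable U" and m: "m \<ge> 1" and d: "set d \<subseteq> V" and \<gamma>: "\<gamma> \<in> U \<rightarrow> tuples V m" "U \<noteq> {}"
  obtains v where "range v \<subseteq> V" "\<And>i. i < length d \<Longrightarrow> v i = d ! i"
    "\<And>x. x \<in> U \<Longrightarrow> map v (point_vars (length d) m U x) = \<gamma> x"
proof
  \<comment> \<open>Behind the parameters, quotient and remainder by \<open>m\<close> give the point
    and the coordinate to which a variable belongs. As \<open>U\<close> is nonempty,
    \<open>from_nat_into\<close> stays in \<open>U\<close> even at indices that enumerate no new
    point.\<close>
  let ?v = "\<lambda>i. if i < length d then d ! i
    else \<gamma> (from_nat_into U ((i - length d) div m)) ! ((i - length d) mod m)"
  have "\<gamma> (from_nat_into U i) \<in> tuples V m" for i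
    using \<gamma> from_nat_into[of U i] by auto
  then have "\<gamma> (from_nat_into U i) ! r \<in> V" if "r < m" for i r
    using that by (metis (mono_tags, lifting) mem_Collect_eq nth_mem subsetD tuples_def)
  then show "range ?v \<subseteq> V"
    using d m by auto
  show "?v i = d ! i" if "i < length d" for i
    using that by simp
  show "map ?v (point_vars (length d) m U x) = \<gamma> x" if x: "x \<in> U" for x
  proof -
    have "length (\<gamma> x) = m"
      using \<gamma> x by (auto simp: tuples_def)
    then show ?thesis
      unfolding point_vars_def using x U by (intro nth_equalityI) auto
  qed
qed

text \<open>The first set consists of implications expressing indiscernibility over the parameter
  variables; exchanging \<open>a\<close> and \<open>b\<close> gives the converses. The second
  prescribes the truth value of each atomic formula of \<open>I\<close> through its tracing formula,
  which will make the picture uncollapsed.\<close>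

definition picture_theory ::
  "('g, 's) fo_language \<Rightarrow> ('g, 's, 'i) fo_structure \<Rightarrow> ('f, 'r) fo_language \<Rightarrow> nat \<Rightarrow> nat \<Rightarrow>
    (('g, 's) fo_formula \<Rightarrow> ('f, 'r) fo_formula) \<Rightarrow> (('g, 's) fo_formula \<Rightarrow> nat list) \<Rightarrow>
    ('f, 'r) fo_formula set" where
  "picture_theory LI I L D m \<psi> js =
     {Neg (Conj (tuple_formula D m (universe I) a ks \<phi>) (Neg (tuple_formula D m (universe I) b ks \<phi>))) |a b ks \<phi>.
        is_formula L \<phi> \<and> set ks \<subseteq> {..<D} \<and> free_vars \<phi> \<subseteq> {..<length a * m + length ks} \<and>
        set a \<subseteq> universe I \<and> set b \<subseteq> universe I \<and> length a \<ge> 1 \<and> length b = length a \<and>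
        tp LI I {} a = tp LI I {} b} \<union>
     {if sat I (nth c) \<chi> then tuple_formula D m (universe I) c (js \<chi>) (\<psi> \<chi>)
        else Neg (tuple_formula D m (universe I) c (js \<chi>) (\<psi> \<chi>)) |\<chi> c.
        \<chi> \<in> atomics LI \<and> c \<in> tuples (universe I) (atomic_width LI)}"

text \<open>The prescribed atomic truth values hold for \<open>\<tau> \<circ> \<sigma>\<close> with
  any automorphism \<open>\<sigma>\<close>, since \<open>\<sigma>\<close> preserves atomic formulas.
  Only finitely many implications occur in a finite part, and \<open>\<sigma>\<close> is chosen for
  these.\<close>

lemma picture_theory_finitely_satisfiable:
  fixes LI :: "('g, 's) fo_language" and I :: "('g, 's, 'i) fo_structure"
    and L :: "('f, 'r) fo_language" and N :: "('f, 'r, 'b) fo_structure"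
  assumes fh: "finitely_homogeneous LI I" and ramsey: "ramsey LI I" and m: "m \<ge> 1"
    and \<tau>: "\<tau> \<in> universe I \<rightarrow> tuples (universe N) m"
    and d: "set d \<subseteq> universe N"
    and \<psi>: "\<And>\<chi>. \<chi> \<in> atomics LI \<Longrightarrow>
      is_formula L (\<psi> \<chi>) \<and> set (js \<chi>) \<subseteq> {..<length d} \<and>
      free_vars (\<psi> \<chi>) \<subseteq> {..<atomic_width LI * m + length (js \<chi>)}"
    and \<psi>_iff: "\<And>\<chi> c. \<chi> \<in> atomics LI \<Longrightarrow> c \<in> tuples (universe I) (atomic_width LI) \<Longrightarrow>
      sat I (nth c) \<chi> \<longleftrightarrow> sat N (nth (concat (map \<tau> c) @ map (nth d) (js \<chi>))) (\<psi> \<chi>)"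
  shows "finitely_satisfiable N (picture_theory LI I L (length d) m \<psi> js) []"
  unfolding finitely_satisfiable_def
proof (intro allI impI)
  let ?U = "universe I"
  let ?tf = "tuple_formula (length d) m ?U"
  have I: "is_structure LI I" and fin: "finite (Rels LI)" and U: "countable ?U" "?U \<noteq> {}"
    using fh by (auto simp: finitely_homogeneous_def is_structure_def)
  define Ind :: "('i list \<times> 'i list \<times> nat list \<times> ('f, 'r) fo_formula) set"
    where "Ind = {(a, b, ks, \<phi>). is_formula L \<phi> \<and> set ks \<subseteq> {..<length d} \<and>
    free_vars \<phi> \<subseteq> {..<length a * m + length ks} \<and> set a \<subseteq> ?U \<and> set b \<subseteq> ?U \<and>
    length a \<ge> 1 \<and> length b = length a \<and> tp LI I {} a = tp LI I {} b}"
  define imp :: "'i list \<times> 'i list \<times> nat list \<times> ('f, 'r) fo_formula \<Rightarrow> ('f, 'r) fo_formula"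
    where "imp = (\<lambda>(a, b, ks, \<phi>). Neg (Conj (?tf a ks \<phi>) (Neg (?tf b ks \<phi>))))"
  fix \<Sigma>0 assume \<Sigma>0: "\<Sigma>0 \<subseteq> picture_theory LI I L (length d) m \<psi> js" "finite \<Sigma>0"
  have "finite (\<Sigma>0 \<inter> imp ` Ind)" "\<Sigma>0 \<inter> imp ` Ind \<subseteq> imp ` Ind"
    using \<Sigma>0(2) by auto
  then obtain J where J: "J \<subseteq> Ind" "finite J" "\<Sigma>0 \<inter> imp ` Ind = imp ` J"
    by (rule finite_subset_image[THEN exE]) blast
  have "\<exists>\<rho>. \<rho> \<in> automorphisms LI I \<and> map \<rho> (fst j) = fst (snd j)" if "j \<in> J" for j
  proof -
    obtain a b ks \<phi> where j: "j = (a, b, ks, \<phi>)"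
      by (metis prod_cases4)
    then have "(a, b, ks, \<phi>) \<in> Ind"
      using that J(1) by auto
    then have "0 < length a" "a \<in> tuples ?U (length a)" "b \<in> tuples ?U (length a)"
      "tp LI I {} a = tp LI I {} b"
      by (auto simp: Ind_def tuples_def)
    then show ?thesis
      unfolding j fst_conv snd_conv by (rule tp_eq_conjugate[OF fh]) blast
  qed
  then obtain \<rho> where \<rho>: "\<And>j. j \<in> J \<Longrightarrow> \<rho> j \<in> automorphisms LI I"
    "\<And>j. j \<in> J \<Longrightarrow> map (\<rho> j) (fst j) = fst (snd j)"
    by metis
  \<comment> \<open>The property to be stabilized for \<open>j\<close> is the truth of its formula
    at the image of a tuple under \<open>\<tau>\<close>; since \<open>\<rho> j\<close> carries the
    first tuple of \<open>j\<close> to the second, stability yields the implication.\<close>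
  define P where "P = (\<lambda>(a :: 'i list, b :: 'i list, ks, \<phi> :: ('f, 'r) fo_formula) c. sat N (nth (concat (map \<tau> c) @ map (nth d) ks)) \<phi>)"
  have J_univ: "set (fst j) \<subseteq> ?U" if "j \<in> J" for j
    using subsetD[OF J(1) that] by (auto simp: Ind_def)
  obtain \<sigma> where \<sigma>: "\<sigma> \<in> automorphisms LI I"
    and \<sigma>_eq: "\<And>j. j \<in> J \<Longrightarrow> P j (map \<sigma> (fst j)) \<longleftrightarrow> P j (map \<sigma> (map (\<rho> j) (fst j)))"
    by (rule ramsey_automorphism[OF fh ramsey J(2), where a = fst and \<rho> = \<rho> and P = P])
      (use J_univ \<rho>(1) in auto)
  have \<sigma>_univ: "\<sigma> x \<in> ?U" if "x \<in> ?U" for x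
    using that automorphism_preserves_rels[OF \<sigma> order_refl] by (auto simp: preserves_rels_def)
  then have "(\<lambda>x. \<tau> (\<sigma> x)) \<in> ?U \<rightarrow> tuples (universe N) m"
    using \<tau> by auto
  then obtain v where v: "range v \<subseteq> universe N" "\<And>i. i < length d \<Longrightarrow> v i = d ! i"
    "\<And>x. x \<in> ?U \<Longrightarrow> map v (point_vars (length d) m ?U x) = \<tau> (\<sigma> x)"
    by (rule assignment_exists[OF U(1) m d _ U(2)]) blast
  have sat_tf: "sat N v (?tf a ks \<phi>) \<longleftrightarrow> sat N (nth (concat (map \<tau> (map \<sigma> a)) @ map (nth d) ks)) \<phi>"
    if "set a \<subseteq> ?U" "set ks \<subseteq> {..<length d}" "free_vars \<phi> \<subseteq> {..<length a * m + length ks}" for a ks \<phi>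
  proof -
    have "map (\<lambda>x. map v (point_vars (length d) m ?U x)) a = map \<tau> (map \<sigma> a)"
      using that v(3) by auto
    moreover have "map v ks = map (nth d) ks"
      using that v(2) by auto
    ultimately show ?thesis
      using sat_tuple_formula[OF that(3)] by metis
  qed
  have "sat N v \<theta>" if "\<theta> \<in> \<Sigma>0" for \<theta>
  proof -
    have "\<theta> \<in> picture_theory LI I L (length d) m \<psi> js"
      using that \<Sigma>0(1) by blast
    then show ?thesis
      unfolding picture_theory_def Un_iff mem_Collect_eq
    proof (elim disjE exE conjE)
      fix a' b' ks' \<phi>'
      assume \<theta>: "\<theta> = Neg (Conj (?tf a' ks' \<phi>') (Neg (?tf b' ks' \<phi>')))"
        and "is_formula L \<phi>'" "set ks' \<subseteq> {..<length d}" "free_vars \<phi>' \<subseteq> {..<length a' * m + length ks'}"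
        "set a' \<subseteq> ?U" "set b' \<subseteq> ?U" "length a' \<ge> 1" "length b' = length a'"
        "tp LI I {} a' = tp LI I {} b'"
      then have "(a', b', ks', \<phi>') \<in> Ind"
        by (simp add: Ind_def)
      moreover have "\<theta> = imp (a', b', ks', \<phi>')"
        by (simp add: imp_def \<theta>)
      \<comment> \<open>The representative of \<open>\<theta>\<close> in \<open>J\<close> may differ
        from the quadruple at hand, and the argument continues with the former.\<close>
      ultimately have "\<theta> \<in> imp ` J"
        using that J(3) by blast
      then obtain j where j: "j \<in> J" "\<theta> = imp j"
        by blast
      obtain a b ks \<phi> where abk: "j = (a, b, ks, \<phi>)"
        by (metis prod_cases4)
      have "P j (map \<sigma> a) \<longleftrightarrow> P j (map \<sigma> b)"
        using \<sigma>_eq[OF j(1)] unfolding \<rho>(2)[OF j(1)] by (simp add: abk)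
      moreover have "(a, b, ks, \<phi>) \<in> Ind"
        using j(1) J(1) abk by auto
      ultimately show ?thesis
        using sat_tf[of a ks \<phi>] sat_tf[of b ks \<phi>] by (auto simp: j(2) abk imp_def P_def Ind_def)
    next
      fix \<chi> c assume \<theta>: "\<theta> = (if sat I (nth c) \<chi> then ?tf c (js \<chi>) (\<psi> \<chi>) else Neg (?tf c (js \<chi>) (\<psi> \<chi>)))"
        and \<chi>: "\<chi> \<in> atomics LI" and c: "c \<in> tuples ?U (atomic_width LI)"
      have "sat I (nth c) \<chi> \<longleftrightarrow> sat I (nth (map \<sigma> c)) \<chi>"
        using \<sigma> I c free_vars_atomics[OF fin \<chi>] atomics_formula[OF \<chi>]
        by (intro sat_isomorphism_nth[symmetric]) (auto simp: automorphisms_def tuples_def)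
      also have "\<dots> \<longleftrightarrow> sat N v (?tf c (js \<chi>) (\<psi> \<chi>))"
        using \<psi>[OF \<chi>] c map_in_tuples[OF c, of \<sigma> ?U] \<sigma>_univ
        by (subst \<psi>_iff[OF \<chi>], blast, subst sat_tf) (auto simp: tuples_def)
      finally show ?thesis
        by (simp add: \<theta>)
    qed
  qed
  then show "\<exists>v. range v \<subseteq> universe N \<and> (\<forall>i<length []. v i = [] ! i) \<and> (\<forall>\<phi>\<in>\<Sigma>0. sat N v \<phi>)"
    using v(1) by auto
qed

text \<open>Each formula over the values of the first \<open>D\<close> variables is a formula in
  these variables, so it is covered by the theory. For the uncollapsed part, atomic facts about
  subtuples are read off from the type of the image, and they determine the type in
  \<open>I\<close>.\<close>

lemma picture_theory_picture:
  assumes fh: "finitely_homogeneous LI I" and v: "range v \<subseteq> universe M"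
    and \<psi>: "\<And>\<chi>. \<chi> \<in> atomics LI \<Longrightarrow>
      is_formula L (\<psi> \<chi>) \<and> set (js \<chi>) \<subseteq> {..<D} \<and>
      free_vars (\<psi> \<chi>) \<subseteq> {..<atomic_width LI * m + length (js \<chi>)}"
    and sat: "\<And>\<theta>. \<theta> \<in> picture_theory LI I L D m \<psi> js \<Longrightarrow> sat M v \<theta>"
  defines "\<gamma> \<equiv> \<lambda>x. map v (point_vars D m (universe I) x)"
  shows "picture I M m \<gamma>"
    and "indiscernible_picture LI I L M (v ` {..<D}) \<gamma>"
    and "uncollapsed_picture LI I L M (v ` {..<D}) \<gamma>"
proof -
  let ?U = "universe I"
  let ?tf = "tuple_formula D m ?U"
  have \<gamma>: "\<gamma> \<in> ?U \<rightarrow> tuples (universe M) m"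
    using v by (auto simp: \<gamma>_def tuples_def image_subset_iff)
  then show "picture I M m \<gamma>"
    by (simp add: picture_def)
  have imp: "holds M (concat (map \<gamma> b)) p"
    if a: "a \<in> tuples ?U k" and b: "b \<in> tuples ?U k" and k: "k \<ge> 1" and tp: "tp LI I {} a = tp LI I {} b"
      and p: "p \<in> param_formulas L (v ` {..<D}) (k * m)" and h: "holds M (concat (map \<gamma> a)) p" for a b k p
  proof -
    obtain \<phi> cs where \<phi>: "p = (\<phi>, cs)"
      by (cases p)
    have "set cs \<subseteq> v ` {..<D}"
      using p by (simp add: \<phi> param_formulas_def)
    \<comment> \<open>The parameters are replaced by variables that have them as values, which gives
      an instance of the first set of the theory.\<close>
    then obtain ks where ks: "set ks \<subseteq> {..<D}" "map v ks = cs"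
      by (rule subset_image_list)
    have fv: "free_vars \<phi> \<subseteq> {..<length a * m + length ks}" "free_vars \<phi> \<subseteq> {..<length b * m + length ks}"
      using p a b by (auto simp: \<phi> param_formulas_def tuples_def simp flip: ks(2))
    have "Neg (Conj (?tf a ks \<phi>) (Neg (?tf b ks \<phi>))) \<in> picture_theory LI I L D m \<psi> js"
      using p a b k tp ks(1) fv(1) unfolding picture_theory_def tuples_def \<phi> param_formulas_def by blast
    then have "sat M v (?tf a ks \<phi>) \<longrightarrow> sat M v (?tf b ks \<phi>)"
      using sat by fastforce
    moreover have "holds M (concat (map \<gamma> c)) p \<longleftrightarrow> sat M v (?tf c ks \<phi>)"
      if "free_vars \<phi> \<subseteq> {..<length c * m + length ks}" for c
      using sat_tuple_formula[OF that, of M v D ?U] by (simp add: \<phi> holds_def \<gamma>_def flip: ks(2))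
    ultimately show ?thesis
      using h fv by blast
  qed
  show "indiscernible_picture LI I L M (v ` {..<D}) \<gamma>"
    unfolding indiscernible_picture_def
  proof (intro allI impI ballI)
    fix k :: nat and a b
    assume k: "1 \<le> k" and a: "a \<in> tuples ?U k" and b: "b \<in> tuples ?U k" and tp: "tp LI I {} a = tp LI I {} b"
    have "length (concat (map \<gamma> a)) = k * m" "length (concat (map \<gamma> b)) = k * m"
      using concat_in_tuples[OF \<gamma> a] concat_in_tuples[OF \<gamma> b] by (auto simp: tuples_def)
    then show "tp L M (v ` {..<D}) (concat (map \<gamma> a)) = tp L M (v ` {..<D}) (concat (map \<gamma> b))"
      using imp[OF a b k tp] imp[OF b a k tp[symmetric]] by (auto simp: tp_def)
  qed
  have atomic: "sat I (nth c) \<chi> \<longleftrightarrow> holds M (concat (map \<gamma> c)) (\<psi> \<chi>, map v (js \<chi>))"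
    if \<chi>: "\<chi> \<in> atomics LI" and c: "c \<in> tuples ?U (atomic_width LI)" for \<chi> c
  proof -
    have fv: "free_vars (\<psi> \<chi>) \<subseteq> {..<length c * m + length (js \<chi>)}"
      using \<psi>[OF \<chi>] c by (simp add: tuples_def)
    have "(if sat I (nth c) \<chi> then ?tf c (js \<chi>) (\<psi> \<chi>) else Neg (?tf c (js \<chi>) (\<psi> \<chi>)))
        \<in> picture_theory LI I L D m \<psi> js"
      using \<chi> c unfolding picture_theory_def by blast
    then have "sat I (nth c) \<chi> \<longleftrightarrow> sat M v (?tf c (js \<chi>) (\<psi> \<chi>))"
      using sat by (fastforce split: if_splits)
    then show ?thesis
      using sat_tuple_formula[OF fv] by (simp add: holds_def \<gamma>_def)
  qed
  show "uncollapsed_picture LI I L M (v ` {..<D}) \<gamma>"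
    unfolding uncollapsed_picture_def
  proof (intro allI impI ballI)
    fix k :: nat and a b
    assume k: "1 \<le> k" and a: "a \<in> tuples ?U k" and b: "b \<in> tuples ?U k"
      and tp: "tp L M (v ` {..<D}) (concat (map \<gamma> a)) = tp L M (v ` {..<D}) (concat (map \<gamma> b))"
    show "tp LI I {} a = tp LI I {} b"
    proof (rule atomically_equivalent_tp_eq[OF fh _ a b])
      fix \<chi> ls assume \<chi>: "\<chi> \<in> atomics LI" and ls: "ls \<in> tuples {..<k} (atomic_width LI)"
      have p: "(\<psi> \<chi>, map v (js \<chi>)) \<in> param_formulas L (v ` {..<D}) (atomic_width LI * m)"
        using \<psi>[OF \<chi>] by (auto simp: param_formulas_def)
      have c: "map (nth c) ls \<in> tuples ?U (atomic_width LI)" if "c \<in> tuples ?U k" for c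
        using that ls nth_mem[of _ c] by (fastforce simp: tuples_def)
      show "sat I (nth (map (nth a) ls)) \<chi> \<longleftrightarrow> sat I (nth (map (nth b) ls)) \<chi>"
        unfolding atomic[OF \<chi> c[OF a]] atomic[OF \<chi> c[OF b]]
        by (rule tp_eq_subtuple[OF \<gamma> a b tp ls p])
    qed (use k in auto)
  qed
qed

section \<open>The equivalences\<close>

text \<open>The structure \<open>N\<close> may live on another type. Taking \<open>N\<close> to be
  \<open>M\<close> itself serves the first equivalence, and an arbitrary model of the theory serves
  the second.\<close>

lemma trace_definition_imp_picture:
  fixes M :: "('f, 'r, 'a) fo_structure" and N :: "('f, 'r, 'b) fo_structure"
  assumes fh: "finitely_homogeneous LI I" and ramsey: "ramsey LI I"
    and M: "is_structure L M" and sat: "highly_saturated \<kappa> L M"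
    and equiv: "\<And>\<phi> e e'. is_sentence L \<phi> \<Longrightarrow> sat N e \<phi> \<Longrightarrow> sat M e' \<phi>"
    and m: "m \<ge> 1" and td: "trace_definition LI I L N m \<tau>"
  shows "has_uncollapsed_indiscernible_picture \<kappa> LI I L M m"
proof -
  have \<kappa>: "saturated \<kappa> L M" "natLeq <o \<kappa>"
    using sat by (auto simp: highly_saturated_def)
  have \<tau>: "\<tau> \<in> universe I \<rightarrow> tuples (universe N) m"
    using td by (simp add: trace_definition_def)
  obtain d \<psi> js where d: "set d \<subseteq> universe N"
    and \<psi>: "\<And>\<chi>. \<chi> \<in> atomics LI \<Longrightarrow>
      is_formula L (\<psi> \<chi>) \<and> set (js \<chi>) \<subseteq> {..<length d} \<and>
      free_vars (\<psi> \<chi>) \<subseteq> {..<atomic_width LI * m + length (js \<chi>)}"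
    and \<psi>_iff: "\<And>\<chi> c. \<chi> \<in> atomics LI \<Longrightarrow> c \<in> tuples (universe I) (atomic_width LI) \<Longrightarrow>
      sat I (nth c) \<chi> \<longleftrightarrow> sat N (nth (concat (map \<tau> c) @ map (nth d) (js \<chi>))) (\<psi> \<chi>)"
    by (rule trace_definition_atomic_formulas[OF fh td]) (rule that; blast)
  let ?\<Sigma> = "picture_theory LI I L (length d) m \<psi> js"
  have \<Sigma>: "?\<Sigma> \<subseteq> {\<phi>. is_formula L \<phi>}"
    using \<psi> by (auto simp: picture_theory_def tuple_formula_def)
  have "finitely_satisfiable N ?\<Sigma> []"
    by (rule picture_theory_finitely_satisfiable[OF fh ramsey m \<tau> d], rule \<psi>, assumption, rule \<psi>_iff)
  then have "finitely_satisfiable M ?\<Sigma> []"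
    by (rule finitely_satisfiable_transfer[OF M _ \<Sigma>, rotated]) (rule equiv)
  then obtain v where v: "range v \<subseteq> universe M" "\<And>\<theta>. \<theta> \<in> ?\<Sigma> \<Longrightarrow> sat M v \<theta>"
    by (rule saturated_realizes[OF M \<kappa> \<Sigma>]) (rule that; blast)
  have "v ` {..<length d} \<subseteq> universe M"
    using v(1) by auto
  moreover have "|v ` {..<length d}| <o \<kappa>"
    using \<kappa>(2) by (intro finite_ordLess_natLeq) auto
  ultimately show ?thesis
    unfolding has_uncollapsed_indiscernible_picture_def
    using picture_theory_picture[OF fh v(1) \<psi> v(2)]
    by (intro exI[of _ "\<lambda>x. map v (point_vars (length d) m (universe I) x)"]
        exI[of _ "v ` {..<length d}"] conjI)
qed

lemma picture_imp_trace_definition: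
  assumes "finitely_homogeneous LI I" "is_structure L M"
    and "has_uncollapsed_indiscernible_picture \<kappa> LI I L M m"
  shows "\<exists>\<tau>. trace_definition LI I L M m \<tau>"
proof -
  obtain \<gamma> A where "picture I M m \<gamma>" "A \<subseteq> universe M"
    "indiscernible_picture LI I L M A \<gamma>" "uncollapsed_picture LI I L M A \<gamma>"
    using assms(3) unfolding has_uncollapsed_indiscernible_picture_def by auto
  then show ?thesis
    by (intro exI uncollapsed_indiscernible_trace_definition[OF assms(1,2)])
qed

text \<open>The same formula works in the copy once its parameters are moved along
  \<open>h\<close>.\<close>

lemma trace_definition_image_structure:
  fixes h :: "'a \<Rightarrow> 'b" and M :: "('f, 'r, 'a) fo_structure"
  assumes M: "is_structure L M" and inj: "inj_on h (universe M)" and td: "trace_definition LI I L M m \<tau>"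
  shows "trace_definition LI I L (image_structure h M) m (\<lambda>x. map h (\<tau> x))"
proof -
  let ?N = "image_structure h M"
  have N: "universe ?N = h ` universe M"
    by (simp add: image_structure_def)
  have \<tau>: "\<tau> \<in> universe I \<rightarrow> tuples (universe M) m"
    using td by (simp add: trace_definition_def)
  have "\<exists>Y. definable L ?N (k * m) Y \<and>
      X = {xs \<in> tuples (universe I) k. concat (map (\<lambda>x. map h (\<tau> x)) xs) \<in> Y}"
    if k: "k \<ge> 1" and X: "definable LI I k X" for k X
  proof -
    obtain Y where Y: "definable L M (k * m) Y"
      "X = {xs \<in> tuples (universe I) k. concat (map \<tau> xs) \<in> Y}"
      using td k X unfolding trace_definition_def by meson
    then obtain \<phi> cs where \<phi>: "(\<phi>, cs) \<in> param_formulas L (universe M) (k * m)"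
      and Y_eq: "Y = {xs \<in> tuples (universe M) (k * m). holds M xs (\<phi>, cs)}"
      by (auto simp: definable_def)
    define Y' where "Y' = {xs \<in> tuples (universe ?N) (k * m). holds ?N xs (\<phi>, map h cs)}"
    have "(\<phi>, map h cs) \<in> param_formulas L (universe ?N) (k * m)"
      using \<phi> by (auto simp: param_formulas_def N)
    then have "definable L ?N (k * m) Y'"
      by (auto simp: definable_def Y'_def)
    moreover have "concat (map (\<lambda>x. map h (\<tau> x)) xs) \<in> Y' \<longleftrightarrow> concat (map \<tau> xs) \<in> Y"
      if xs: "xs \<in> tuples (universe I) k" for xs
    proof -
      let ?ys = "concat (map \<tau> xs)"
      have ys: "?ys \<in> tuples (universe M) (k * m)"
        by (rule concat_in_tuples[OF \<tau> xs])
      have sub: "set (?ys @ cs) \<subseteq> universe M" "free_vars \<phi> \<subseteq> {..<length (?ys @ cs)}" "is_formula L \<phi>"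
        using ys \<phi> by (auto simp: tuples_def param_formulas_def)
      have "sat ?N (nth (map (restrict h (universe M)) (?ys @ cs))) \<phi> \<longleftrightarrow> sat M (nth (?ys @ cs)) \<phi>"
        using sub by (intro sat_isomorphism_nth[OF image_structure(2)[OF M inj] M])
      moreover have "map (restrict h (universe M)) (?ys @ cs) = map h (?ys @ cs)"
        using sub(1) by (intro map_cong) auto
      ultimately have "holds ?N (map h ?ys) (\<phi>, map h cs) \<longleftrightarrow> holds M ?ys (\<phi>, cs)"
        by (simp add: holds_def del: map_eq_conv)
      moreover have "concat (map (\<lambda>x. map h (\<tau> x)) xs) = map h ?ys"
        by (simp add: map_concat comp_def)
      moreover have "map h ?ys \<in> tuples (universe ?N) (k * m)"
        using ys by (auto simp: tuples_def N)
      ultimately show ?thesis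
        using ys by (simp only: Y_eq Y'_def mem_Collect_eq simp_thms)
    qed
    ultimately show ?thesis
      using Y(2) by blast
  qed
  moreover have "(\<lambda>x. map h (\<tau> x)) \<in> universe I \<rightarrow> tuples (universe ?N) m"
    using \<tau> by (fastforce simp: tuples_def N)
  ultimately show ?thesis
    unfolding trace_definition_def by blast
qed

theorem proposition2p8:
  fixes LI :: "('g, 's) fo_language" and I :: "('g, 's, 'i) fo_structure"
    and L :: "('f, 'r) fo_language" and T :: "('f, 'r) fo_formula set"
    and M :: "('f, 'r, 'a) fo_structure" and \<kappa> :: "'k rel" and m :: nat
  assumes "finitely_homogeneous LI I" and "ramsey LI I"
    and "consistent_theory TYPE('a + 'u) L T" and "complete_theory TYPE('a + 'u) L T"
    and "is_model L T M" and "highly_saturated \<kappa> L M"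
    and "m \<ge> 1"
  shows "((\<exists>\<tau>. trace_definition LI I L M m \<tau>)
            \<longleftrightarrow> has_uncollapsed_indiscernible_picture \<kappa> LI I L M m)
       \<and> (trace_defines TYPE('a + 'u) L T LI I
            \<longleftrightarrow> (\<exists>n\<ge>1. has_uncollapsed_indiscernible_picture \<kappa> LI I L M n))"
proof -
  have M: "is_structure L M"
    using assms(5) by (simp add: is_model_def)
  have self: "sat M e' \<phi>" if "is_sentence L \<phi>" "sat M e \<phi>" for \<phi> e e'
    using that is_model_sentence_iff[OF M] by blast
  let ?N = "image_structure (Inl :: 'a \<Rightarrow> 'a + 'u) M"
  have inj: "inj_on (Inl :: 'a \<Rightarrow> 'a + 'u) (universe M)"
    by simp
  have N: "is_model L T ?N"
    using assms(4,5) by (intro is_model_image_structure) (auto simp: complete_theory_def)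
  \<comment> \<open>Completeness speaks about models over \<open>'a + 'u\<close>. The model
    \<open>N'\<close> of \<open>\<phi>\<close> rules out that \<open>Neg \<phi>\<close> is entailed,
    so \<open>\<phi>\<close> is entailed; it then holds in the copy of \<open>M\<close> and, by
    isomorphism, in \<open>M\<close>.\<close>
  have equiv: "sat M e' \<phi>" if N': "is_model L T N'" and \<phi>: "is_sentence L \<phi>" "sat N' e \<phi>"
    for N' :: "('f, 'r, 'a + 'u) fo_structure" and \<phi> e e'
  proof -
    have str: "is_structure L N'" "is_structure L ?N"
      using N N' by (auto simp: is_model_def)
    have "is_sentence L (Neg \<phi>)"
      using \<phi> by (simp add: is_sentence_def)
    then have "\<not> is_model L {Neg \<phi>} N'"
      using \<phi> is_model_sentence_iff[OF str(1), of "Neg \<phi>" e] by simp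
    then have "entails TYPE('a + 'u) L T \<phi>"
      using assms(4) \<phi> N' unfolding complete_theory_def entails_def by blast
    then have "is_model L {\<phi>} ?N"
      using N by (auto simp: entails_def)
    then show ?thesis
      using is_model_sentence_iff[OF str(2) \<phi>(1)]
        sat_sentence_isomorphism[OF image_structure(2)[OF M inj] M \<phi>(1)] by blast
  qed
  have "trace_defines TYPE('a + 'u) L T LI I"
    if n: "n \<ge> 1" "has_uncollapsed_indiscernible_picture \<kappa> LI I L M n" for n
  proof -
    obtain \<tau> where "trace_definition LI I L M n \<tau>"
      using picture_imp_trace_definition[OF assms(1) M n(2)] by blast
    then have "trace_definition LI I L ?N n (\<lambda>x. map Inl (\<tau> x))"
      by (rule trace_definition_image_structure[OF M inj])
    then show ?thesis
      unfolding trace_defines_def using n(1) N by blast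
  qed
  moreover have "\<exists>n\<ge>1. has_uncollapsed_indiscernible_picture \<kappa> LI I L M n"
    if trace: "trace_defines TYPE('a + 'u) L T LI I"
  proof -
    obtain n \<tau> and N' :: "('f, 'r, 'a + 'u) fo_structure"
      where n: "n \<ge> 1" and N': "is_model L T N'" and \<tau>: "trace_definition LI I L N' n \<tau>"
      using trace unfolding trace_defines_def by blast
    have "has_uncollapsed_indiscernible_picture \<kappa> LI I L M n"
      by (rule trace_definition_imp_picture[OF assms(1,2) M assms(6) _ n \<tau>]) (rule equiv[OF N'])
    then show ?thesis
      using n by blast
  qed
  moreover have "(\<exists>\<tau>. trace_definition LI I L M m \<tau>)
      \<longleftrightarrow> has_uncollapsed_indiscernible_picture \<kappa> LI I L M m"
  proof
    assume "\<exists>\<tau>. trace_definition LI I L M m \<tau>"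
    then obtain \<tau> where \<tau>: "trace_definition LI I L M m \<tau>" ..
    show "has_uncollapsed_indiscernible_picture \<kappa> LI I L M m"
      by (rule trace_definition_imp_picture[OF assms(1,2) M assms(6) _ assms(7) \<tau>]) (rule self)
  qed (rule picture_imp_trace_definition[OF assms(1) M])
  ultimately show ?thesis
    by blast
qed

end
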